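(* Consider the state-evolution recursion $\tau_i^{(t)}=f(v_i^{(t)})$, $v_{i+1}^{(t)}=g_t(\tau_i^{(t)})$, $i=0,1,2,\dots$, with $v_0^{(t)}=\mathrm{Var}[x^{(t)}]$, in rounds $t=1,\dots,T$. Assume that $\{x^{(t)}\}_{t=1}^T$ is strictly stationary. Then for every $i=1,2,\dots$ and every $t\le T$, $$\tau_i^{(t)}\le\tau_i^{(t-1)}\le\cdots\le\tau_i^{(1)},\qquad v_i^{(t)}\le v_i^{(t-1)}\le\cdots\le v_i^{(1)}.$$ In particular, the same monotonicity holds for the fixed points $\{\tau_*^{(t)}\}_{t=1}^T$ and $\{v_*^{(t)}\}_{t=1}^T$, i.e. $\tau_*^{(t)}\le\tau_*^{(t-1)}\le\cdots\le\tau_*^{(1)}$ and $v_*^{(t)}\le v_*^{(t-1)}\le\cdots\le v_*^{(1)}$.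
   Context: Let $N\ge s\ge 1$ be integers and $\sigma^2>0$ a constant (the same for all rounds). Let $\{x^{(t)}\}_{t=1}^T$ be a real-valued Markov process with finite variances: $p(x^{(1)},\dots,x^{(T)})=\prod_{t=1}^T p(x^{(t)}|x^{(t-1)})$, where the $t=1$ factor is the law of $x^{(1)}$. (It represents a generic component of a vector process $\mathbf{x}^{(t)}\in\mathbb{R}^N$ whose components evolve independently and identically.) Let $\{w^{(t)}\}_{t=1}^T$ be i.i.d. $\mathcal N(0,1)$ random variables independent of $\{x^{(t)}\}_{t=1}^T$. For a random variable $x$ and a family of observations $z;\mathcal Z$, write $\mathrm{mmse}(x|z;\mathcal Z)=\mathbb E[(x-\mathbb E[x|z,\mathcal Z])^2]$. Transfer functions: for $v\ge 0$ and $\tau>0$, $$f(v)=\Big(\frac{N}{s}-1\Big)v+\sigma^2,\qquad g_t(\tau)=\Big(\frac{1}{\phi_t(\tau)}-\frac{1}{\tau}\Big)^{-1}$$ (with the conventions $1/0=\infty$, $1/\infty=0$), where $$\phi_t(\tau)=\phi_t(\tau;\tau_*^{(t-1)},\dots,\tau_*^{(1)})=\mathrm{mmse}\big(x^{(t)}\,\big|\,x^{(t)}+\sqrt{\tau}\,w^{(t)};\ \{x^{(j)}+\sqrt{\tau_*^{(j)}}\,w^{(j)}\}_{j=1}^{t-1}\big).$$ The rounds are defined successively in $t$: $\tau_*^{(t)}$ and $v_*^{(t)}$ denote the fixed point of the round-$t$ recursion, i.e. the limits as $i\to\infty$ of $\{\tau_i^{(t)}\}_i$ and $\{v_i^{(t)}\}_i$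 (these limits exist because, in each round, both sequences are nonincreasing in $i$ and bounded below); $\phi_t$ uses the limits $\tau_*^{(j)}$ of the earlier rounds $j<t$, and for $t=1$ there are no past observations. *)

theory Defs
  imports "HOL-Probability.Probability"
begin

text \<open>
  Path law of a Markov chain started at time 1: \<open>K 1\<close> is the (constant) initial kernel,
  and \<open>K t y\<close> is the transition law of the state at time \<open>t\<close> given the state \<open>y\<close> at time \<open>t - 1\<close>.
  The index-0 path is the empty one, so for \<open>n = 0\<close> the argument \<open>\<omega> 0\<close> of \<open>K 1\<close> is a dummy.
\<close>

primrec path_law :: "(nat \<Rightarrow> real \<Rightarrow> real measure) \<Rightarrow> nat \<Rightarrow> (nat \<Rightarrow> real) measure" where
  "path_law K 0 = return (PiM {1..0} (\<lambda>_. borel)) (\<lambda>_. undefined)"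
| "path_law K (Suc n) = path_law K n \<bind>
     (\<lambda>\<omega>. distr (K (Suc n) (\<omega> n)) (PiM {1..Suc n} (\<lambda>_. borel)) (fun_upd \<omega> (Suc n)))"

text \<open>
  The factorisation \<open>p(x\<^sub>1, \<dots>, x\<^sub>T) = p(x\<^sub>1) \<cdot> \<Prod>t=2..T. p(x\<^sub>t | x\<^sub>t\<^sub>-\<^sub>1)\<close>, expressed with
  Markov kernels so that the laws need not have densities. The identity forces \<open>K t\<close> to be a
  regular conditional law of \<open>x t\<close> given \<open>x (t - 1)\<close>.
\<close>

definition markov_process :: "'a measure \<Rightarrow> nat \<Rightarrow> (nat \<Rightarrow> 'a \<Rightarrow> real) \<Rightarrow> bool" where
  "markov_process M T x \<longleftrightarrow>
     (\<exists>K. K 1 = (\<lambda>_. distr M borel (x 1)) \<and>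
          (\<forall>t\<in>{2..T}. K t \<in> borel \<rightarrow>\<^sub>M prob_algebra borel) \<and>
          distr M (PiM {1..T} (\<lambda>_. borel)) (\<lambda>\<omega>. \<lambda>t\<in>{1..T}. x t \<omega>) = path_law K T)"

definition strictly_stationary :: "'a measure \<Rightarrow> nat \<Rightarrow> (nat \<Rightarrow> 'a \<Rightarrow> real) \<Rightarrow> bool" where
  "strictly_stationary M T x \<longleftrightarrow>
     (\<forall>J h. J \<subseteq> {1..T} \<and> (\<forall>j\<in>J. j + h \<le> T) \<longrightarrow>
        distr M (PiM J (\<lambda>_. borel)) (\<lambda>\<omega>. \<lambda>j\<in>J. x (j + h) \<omega>) =
        distr M (PiM J (\<lambda>_. borel)) (\<lambda>\<omega>. \<lambda>j\<in>J. x j \<omega>))"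

text \<open>The mean-square error of \<open>E[X | z, (Z j)\<^sub>j\<^sub>\<in>\<^sub>J]\<close>.\<close>

definition mmse :: "'a measure \<Rightarrow> ('a \<Rightarrow> real) \<Rightarrow> ('a \<Rightarrow> real) \<Rightarrow> nat set \<Rightarrow> (nat \<Rightarrow> 'a \<Rightarrow> real) \<Rightarrow> real" where
  "mmse M X z J Z =
     (let F = vimage_algebra (space M) (\<lambda>\<omega>. (z \<omega>, \<lambda>j\<in>J. Z j \<omega>)) (borel \<Otimes>\<^sub>M PiM J (\<lambda>_. borel))
      in \<integral>\<omega>. (X \<omega> - real_cond_exp M F X \<omega>)\<^sup>2 \<partial>M)"

definition se_f :: "nat \<Rightarrow> nat \<Rightarrow> real \<Rightarrow> real \<Rightarrow> real" where
  "se_f N s sigma2 v = (real N / real s - 1) * v + sigma2"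

text \<open>In round \<open>t\<close> only the values \<open>taus j\<close> with \<open>1 \<le> j < t\<close> are used.\<close>

definition se_phi ::
  "'a measure \<Rightarrow> (nat \<Rightarrow> 'a \<Rightarrow> real) \<Rightarrow> (nat \<Rightarrow> 'a \<Rightarrow> real) \<Rightarrow> (nat \<Rightarrow> real) \<Rightarrow> nat \<Rightarrow> real \<Rightarrow> real" where
  "se_phi M x w taus t \<tau> =
     mmse M (x t) (\<lambda>\<omega>. x t \<omega> + sqrt \<tau> * w t \<omega>)
       {1..<t} (\<lambda>j \<omega>. x j \<omega> + sqrt (taus j) * w j \<omega>)"

text \<open>
  Division is taken in the extended reals, where \<open>1 / 0 = \<infinity>\<close> and \<open>1 / \<infinity> = 0\<close>; real division
  would give a wrong value when \<open>\<phi> = 0\<close>. The result is finite in all cases of interest: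
  linear estimation gives \<open>\<phi> \<le> Var \<tau> / (Var + \<tau>) < \<tau>\<close>.
\<close>

definition se_g ::
  "'a measure \<Rightarrow> (nat \<Rightarrow> 'a \<Rightarrow> real) \<Rightarrow> (nat \<Rightarrow> 'a \<Rightarrow> real) \<Rightarrow> (nat \<Rightarrow> real) \<Rightarrow> nat \<Rightarrow> real \<Rightarrow> real" where
  "se_g M x w taus t \<tau> =
     real_of_ereal (1 / (1 / ereal (se_phi M x w taus t \<tau>) - 1 / ereal \<tau>))"

primrec se_iter ::
  "'a measure \<Rightarrow> (nat \<Rightarrow> 'a \<Rightarrow> real) \<Rightarrow> (nat \<Rightarrow> 'a \<Rightarrow> real) \<Rightarrow> nat \<Rightarrow> nat \<Rightarrow> real
     \<Rightarrow> (nat \<Rightarrow> real) \<Rightarrow> nat \<Rightarrow> nat \<Rightarrow> real" where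
  "se_iter M x w N s sigma2 taus t 0 = prob_space.variance M (x t)"
| "se_iter M x w N s sigma2 taus t (Suc i) =
     se_g M x w taus t (se_f N s sigma2 (se_iter M x w N s sigma2 taus t i))"

text \<open>
  Recursion over the rounds: round \<open>t\<close> uses the limits of the earlier rounds only
  (the value 0 below is never used, and neither is round 0).
\<close>

fun tau_star ::
  "'a measure \<Rightarrow> (nat \<Rightarrow> 'a \<Rightarrow> real) \<Rightarrow> (nat \<Rightarrow> 'a \<Rightarrow> real) \<Rightarrow> nat \<Rightarrow> nat \<Rightarrow> real \<Rightarrow> nat \<Rightarrow> real" where
  "tau_star M x w N s sigma2 t =
     lim (\<lambda>i. se_f N s sigma2
       (se_iter M x w N s sigma2 (\<lambda>j. if j < t then tau_star M x w N s sigma2 j else 0) t i))"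

declare tau_star.simps [simp del]

definition se_v ::
  "'a measure \<Rightarrow> (nat \<Rightarrow> 'a \<Rightarrow> real) \<Rightarrow> (nat \<Rightarrow> 'a \<Rightarrow> real) \<Rightarrow> nat \<Rightarrow> nat \<Rightarrow> real \<Rightarrow> nat \<Rightarrow> nat \<Rightarrow> real" where
  "se_v M x w N s sigma2 t i = se_iter M x w N s sigma2 (tau_star M x w N s sigma2) t i"

definition se_tau ::
  "'a measure \<Rightarrow> (nat \<Rightarrow> 'a \<Rightarrow> real) \<Rightarrow> (nat \<Rightarrow> 'a \<Rightarrow> real) \<Rightarrow> nat \<Rightarrow> nat \<Rightarrow> real \<Rightarrow> nat \<Rightarrow> nat \<Rightarrow> real" where
  "se_tau M x w N s sigma2 t i = se_f N s sigma2 (se_v M x w N s sigma2 t i)"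

definition v_star ::
  "'a measure \<Rightarrow> (nat \<Rightarrow> 'a \<Rightarrow> real) \<Rightarrow> (nat \<Rightarrow> 'a \<Rightarrow> real) \<Rightarrow> nat \<Rightarrow> nat \<Rightarrow> real \<Rightarrow> nat \<Rightarrow> real" where
  "v_star M x w N s sigma2 t = lim (se_v M x w N s sigma2 t)"

lemma se_phi_cong:
  assumes "\<And>j. 1 \<le> j \<Longrightarrow> j < t \<Longrightarrow> taus j = taus' j"
  shows "se_phi M x w taus t = se_phi M x w taus' t"
proof -
  have "(\<lambda>\<omega>. \<lambda>j\<in>{1..<t}. x j \<omega> + sqrt (taus j) * w j \<omega>) =
        (\<lambda>\<omega>. \<lambda>j\<in>{1..<t}. x j \<omega> + sqrt (taus' j) * w j \<omega>)"
    using assms by (intro ext) (auto simp: restrict_def)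
  then show ?thesis
    unfolding se_phi_def mmse_def by (intro ext) (metis (no_types, lifting))
qed

lemma se_iter_cong:
  assumes "\<And>j. 1 \<le> j \<Longrightarrow> j < t \<Longrightarrow> taus j = taus' j"
  shows "se_iter M x w N s sigma2 taus t i = se_iter M x w N s sigma2 taus' t i"
  by (induction i) (simp_all add: se_g_def se_phi_cong[OF assms])

lemma tau_star_eq_lim: "tau_star M x w N s sigma2 t = lim (se_tau M x w N s sigma2 t)"
proof -
  have "se_iter M x w N s sigma2 (\<lambda>j. if j < t then tau_star M x w N s sigma2 j else 0) t i =
        se_v M x w N s sigma2 t i" for i
    unfolding se_v_def by (rule se_iter_cong) simp
  then show ?thesis
    by (subst tau_star.simps) (simp add: se_tau_def[abs_def])
qed

lemma se_v_0: "se_v M x w N s sigma2 t 0 = prob_space.variance M (x t)"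
  by (simp add: se_v_def)

lemma se_v_Suc: "se_v M x w N s sigma2 t (Suc i) =
    se_g M x w (tau_star M x w N s sigma2) t (se_tau M x w N s sigma2 t i)"
  by (simp add: se_v_def se_tau_def)

end

theory Submission
  imports Defs
begin

text \<open>
  The mean-square error depends only on the joint law of signal and observations, and it is the
  infimum of the risk over all estimators. Hence it can be bounded by the risk of any estimator that
  may in addition use an independent Gaussian \<open>u\<close>: averaging over \<open>u\<close> cannot beat the infimum.
  Adding \<open>u\<close> to an observation simulates a noisier one, so the error is monotone in every noise
  variance. By stationarity, round \<open>t\<close> is round \<open>t + 1\<close> without its first observation, and by
  induction the remaining observations of round \<open>t + 1\<close> are less noisy. So \<open>g\<^sub>t\<^sub>+\<^sub>1 \<le> g\<^sub>t\<close>
  pointwise.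

  It remains to see that \<open>g\<^sub>t\<close> is nondecreasing. This would follow from the formula for the
  derivative of the mean-square error with respect to the signal-to-noise ratio, but a convex
  combination of two estimators is enough. An observation of noise variance \<open>\<tau>1 < \<tau>2\<close> and \<open>u\<close>
  together provide two observations with independent noises of precisions \<open>1/\<tau>2\<close> and
  \<open>1/\<tau>1 - 1/\<tau>2\<close>; averaging the optimal estimator for the first with the second observation,
  with the best weight, gives
  \<open>1/\<phi>(\<tau>1) \<ge> 1/\<phi>(\<tau>2) + (1/\<tau>1 - 1/\<tau>2)\<close>, that is, \<open>g(\<tau>1) \<le> g(\<tau>2)\<close>.
\<close>

section \<open>The standard Gaussian on the line: rotation invariance and second moments\<close>

section \<open>Gaussian measure\<close>

definition gauss :: "real measure" where
  "gauss = density lborel std_normal_density"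

lemma sets_gauss [measurable_cong, simp]: "sets gauss = sets borel"
  by (simp add: gauss_def)

lemma space_gauss [simp]: "space gauss = UNIV"
  by (simp add: gauss_def)

lemma prob_space_gauss: "prob_space gauss"
  unfolding gauss_def by (rule prob_space_normal_density) simp

lemma nn_integral_gauss:
  "f \<in> borel_measurable borel \<Longrightarrow>
    (\<integral>\<^sup>+x. f x \<partial>gauss) = (\<integral>\<^sup>+x. ennreal (std_normal_density x) * f x \<partial>lborel)"
  unfolding gauss_def by (subst nn_integral_density) auto

text \<open>
  A reflection of the plane is a product of shears and scalings of a single coordinate, so its
  invariance follows from the one-dimensional affine substitution.
\<close>

lemma nn_integral_gauss_rotate:
  fixes F :: "real \<Rightarrow> real \<Rightarrow> ennreal"
  assumes F [measurable]: "case_prod F \<in> borel_measurable (borel \<Otimes>\<^sub>M borel)"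
    and ab: "a\<^sup>2 + b\<^sup>2 = 1" and a: "a \<noteq> 0"
  shows "(\<integral>\<^sup>+x. \<integral>\<^sup>+y. F (a * x + b * y) (b * x - a * y) \<partial>gauss \<partial>gauss) =
         (\<integral>\<^sup>+x. \<integral>\<^sup>+y. F x y \<partial>gauss \<partial>gauss)"
proof -
  define D where "D x y = ennreal (std_normal_density x * std_normal_density y)" for x y :: real
  have [measurable]: "case_prod D \<in> borel_measurable (borel \<Otimes>\<^sub>M borel)"
    unfolding D_def by measurable
  have gg: "(\<integral>\<^sup>+x. \<integral>\<^sup>+y. G x y \<partial>gauss \<partial>gauss) = (\<integral>\<^sup>+x. \<integral>\<^sup>+y. D x y * G x y \<partial>lborel \<partial>lborel)"
    if [measurable]: "case_prod G \<in> borel_measurable (borel \<Otimes>\<^sub>M borel)" for G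
  proof -
    interpret prob_space gauss by (rule prob_space_gauss)
    have "(\<integral>\<^sup>+x. \<integral>\<^sup>+y. G x y \<partial>gauss \<partial>gauss) =
      (\<integral>\<^sup>+x. ennreal (std_normal_density x) * (\<integral>\<^sup>+y. G x y \<partial>gauss) \<partial>lborel)"
      by (subst nn_integral_gauss) auto
    also have "\<dots> = (\<integral>\<^sup>+x. \<integral>\<^sup>+y. D x y * G x y \<partial>lborel \<partial>lborel)"
      by (intro nn_integral_cong)
        (simp add: nn_integral_gauss nn_integral_cmult[symmetric] D_def ennreal_mult' mult.assoc)
    finally show ?thesis .
  qed
  have D_rot: "D (a * u + b * v) (b * u - a * v) = D u v" for u v
  proof -
    have "(a * u + b * v)\<^sup>2 + (b * u - a * v)\<^sup>2 = (a\<^sup>2 + b\<^sup>2) * (u\<^sup>2 + v\<^sup>2)"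
      by (simp add: power2_eq_square algebra_simps)
    then have "- (a * u + b * v)\<^sup>2 / 2 + - (b * u - a * v)\<^sup>2 / 2 = - u\<^sup>2 / 2 + - v\<^sup>2 / 2"
      using ab by (simp add: field_simps)
    then have "exp (- (a * u + b * v)\<^sup>2 / 2) * exp (- (b * u - a * v)\<^sup>2 / 2) =
        exp (- u\<^sup>2 / 2) * exp (- v\<^sup>2 / 2)"
      by (metis exp_add)
    then show ?thesis
      unfolding D_def std_normal_density_def by (simp add: algebra_simps)
  qed
  \<comment> \<open>Identities for two successive affine substitutions:
    \<open>u = a * x + b * y\<close> with \<open>y\<close> fixed, then
    \<open>y = b * u - a * v\<close> with \<open>u\<close> fixed, which makes
    \<open>v = b * x - a * y\<close>. The Jacobian factors \<open>1 / |a|\<close> and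
    \<open>|a|\<close> cancel; Fubini brings the substituted variable to the inner integral each
    time.\<close>
  have s1: "a * (- b * y / a + 1 / a * u) + b * y = u" for u y
    using a by (simp add: field_simps)
  have s2: "b * (- b * (b * u + - a * v) / a + 1 / a * u) - a * (b * u + - a * v) = v" (is "?l = _") for u v
  proof -
    have "?l * a = u * b * (1 - a\<^sup>2 - b\<^sup>2) + v * a * (a\<^sup>2 + b\<^sup>2)"
      using a by (simp add: field_simps power2_eq_square)
    also have "1 - a\<^sup>2 - b\<^sup>2 = 0" using ab by simp
    finally show ?thesis using a ab by simp
  qed
  have s3: "- b * (b * u + - a * v) / a + 1 / a * u = a * u + b * v" (is "?l = _") for u v
  proof -
    have "?l * a = u * (1 - b\<^sup>2) + v * a * b"
      using a by (simp add: field_simps power2_eq_square)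
    also have "1 - b\<^sup>2 = a\<^sup>2" using ab by simp
    finally have "?l * a = (a * u + b * v) * a" by (simp add: power2_eq_square algebra_simps)
    then show ?thesis using a by simp
  qed
  have "(\<integral>\<^sup>+x. \<integral>\<^sup>+y. F (a * x + b * y) (b * x - a * y) \<partial>gauss \<partial>gauss) =
      (\<integral>\<^sup>+x. \<integral>\<^sup>+y. D x y * F (a * x + b * y) (b * x - a * y) \<partial>lborel \<partial>lborel)"
    by (rule gg) measurable
  also have "\<dots> = (\<integral>\<^sup>+y. \<integral>\<^sup>+x. D x y * F (a * x + b * y) (b * x - a * y) \<partial>lborel \<partial>lborel)"
    by (rule lborel_pair.Fubini'[symmetric]) measurable
  also have "\<dots> = (\<integral>\<^sup>+y. \<integral>\<^sup>+u. ennreal \<bar>1 / a\<bar> *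
      (D (- b * y / a + 1 / a * u) y * F u (b * (- b * y / a + 1 / a * u) - a * y)) \<partial>lborel \<partial>lborel)"
  proof (rule nn_integral_cong)
    fix y :: real
    have "(\<integral>\<^sup>+x. D x y * F (a * x + b * y) (b * x - a * y) \<partial>lborel) =
        ennreal \<bar>1 / a\<bar> * (\<integral>\<^sup>+u. D (- b * y / a + 1 / a * u) y *
          F (a * (- b * y / a + 1 / a * u) + b * y) (b * (- b * y / a + 1 / a * u) - a * y) \<partial>lborel)"
      using a by (intro nn_integral_real_affine) auto
    also have "\<dots> = (\<integral>\<^sup>+u. ennreal \<bar>1 / a\<bar> *
        (D (- b * y / a + 1 / a * u) y * F u (b * (- b * y / a + 1 / a * u) - a * y)) \<partial>lborel)"
      unfolding s1 by (rule nn_integral_cmult[symmetric]) measurable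
    finally show "(\<integral>\<^sup>+x. D x y * F (a * x + b * y) (b * x - a * y) \<partial>lborel) =
      (\<integral>\<^sup>+u. ennreal \<bar>1 / a\<bar> *
        (D (- b * y / a + 1 / a * u) y * F u (b * (- b * y / a + 1 / a * u) - a * y)) \<partial>lborel)" .
  qed
  also have "\<dots> = (\<integral>\<^sup>+u. \<integral>\<^sup>+y. ennreal \<bar>1 / a\<bar> *
      (D (- b * y / a + 1 / a * u) y * F u (b * (- b * y / a + 1 / a * u) - a * y)) \<partial>lborel \<partial>lborel)"
    by (rule lborel_pair.Fubini') measurable
  also have "\<dots> = (\<integral>\<^sup>+u. \<integral>\<^sup>+v. D u v * F u v \<partial>lborel \<partial>lborel)"
  proof (rule nn_integral_cong)
    fix u :: real
    have "(\<integral>\<^sup>+y. ennreal \<bar>1 / a\<bar> *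
        (D (- b * y / a + 1 / a * u) y * F u (b * (- b * y / a + 1 / a * u) - a * y)) \<partial>lborel) =
      ennreal \<bar>- a\<bar> * (\<integral>\<^sup>+v. ennreal \<bar>1 / a\<bar> *
        (D (- b * (b * u + - a * v) / a + 1 / a * u) (b * u + - a * v) *
         F u (b * (- b * (b * u + - a * v) / a + 1 / a * u) - a * (b * u + - a * v))) \<partial>lborel)"
      using a by (intro nn_integral_real_affine) auto
    also have "\<dots> = ennreal \<bar>- a\<bar> *
        (\<integral>\<^sup>+v. ennreal \<bar>1 / a\<bar> * (D (a * u + b * v) (b * u - a * v) * F u v) \<partial>lborel)"
      using s2 unfolding s3 by simp
    also have "\<dots> = (\<integral>\<^sup>+v. ennreal \<bar>a\<bar> * (ennreal \<bar>1 / a\<bar> * (D u v * F u v)) \<partial>lborel)"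
      by (subst nn_integral_cmult[symmetric]) (auto simp: D_rot)
    also have "\<dots> = (\<integral>\<^sup>+v. D u v * F u v \<partial>lborel)"
      using a by (intro nn_integral_cong)
        (simp add: mult.assoc[symmetric] ennreal_mult[symmetric] abs_mult[symmetric])
    finally show "(\<integral>\<^sup>+y. ennreal \<bar>1 / a\<bar> *
        (D (- b * y / a + 1 / a * u) y * F u (b * (- b * y / a + 1 / a * u) - a * y)) \<partial>lborel) = 
        (\<integral>\<^sup>+v. D u v * F u v \<partial>lborel)" .
  qed
  also have "\<dots> = (\<integral>\<^sup>+x. \<integral>\<^sup>+y. F x y \<partial>gauss \<partial>gauss)"
    by (rule gg[symmetric]) measurable
  finally show ?thesis .
qed

text \<open>The zero mean kills the cross term. This is what splits every risk below into an
  estimation part and a noise part.\<close>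

lemma nn_integral_gauss_square:
  "(\<integral>\<^sup>+u. ennreal ((a + b * u)\<^sup>2) \<partial>gauss) = ennreal (a\<^sup>2 + b\<^sup>2)"
proof -
  have "has_bochner_integral lborel std_normal_density 1"
    using normal_moment_even[of 1 0 0] by simp
  moreover have "has_bochner_integral lborel (\<lambda>u. std_normal_density u * u) 0"
    using normal_moment_odd[of 1 0 0] by simp
  moreover have "has_bochner_integral lborel (\<lambda>u. std_normal_density u * u\<^sup>2) 1"
    using normal_moment_even[of 1 0 1] by (simp add: fact_numeral)
  ultimately have "has_bochner_integral lborel (\<lambda>u. a\<^sup>2 * std_normal_density u +
      2 * a * b * (std_normal_density u * u) + b\<^sup>2 * (std_normal_density u * u\<^sup>2))
      (a\<^sup>2 * 1 + 2 * a * b * 0 + b\<^sup>2 * 1)"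
    by (intro has_bochner_integral_add has_bochner_integral_mult_right)
  then have "has_bochner_integral lborel (\<lambda>u. std_normal_density u * (a + b * u)\<^sup>2) (a\<^sup>2 + b\<^sup>2)"
    by (simp add: power2_eq_square algebra_simps)
  then have "(\<integral>\<^sup>+u. ennreal (std_normal_density u * (a + b * u)\<^sup>2) \<partial>lborel) = ennreal (a\<^sup>2 + b\<^sup>2)"
    by (simp add: has_bochner_integral_iff nn_integral_eq_integral)
  then show ?thesis
    by (simp add: nn_integral_gauss ennreal_mult')
qed

section \<open>Bayes risk of estimating one coordinate of a noisy vector\<close>

section \<open>Risk of estimators under Gaussian noise\<close>

definition noise :: "'i set \<Rightarrow> ('i \<Rightarrow> real) measure" where
  "noise J = PiM J (\<lambda>_. gauss)"

definition observe :: "'i set \<Rightarrow> ('i \<Rightarrow> real) \<Rightarrow> ('i \<Rightarrow> real) \<Rightarrow> ('i \<Rightarrow> real) \<Rightarrow> 'i \<Rightarrow> real" where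
  "observe J \<rho> x w = (\<lambda>j\<in>J. x j + sqrt (\<rho> j) * w j)"

text \<open>Values in \<open>ennreal\<close> let every measurable estimator compete, with no
  integrability condition. For \<open>t\<close> in \<open>J\<close> the noisy version of the target
  is one of the entries of the observed vector, so current and past observations are treated
  alike.\<close>

definition risk :: "('i \<Rightarrow> real) measure \<Rightarrow> 'i set \<Rightarrow> 'i \<Rightarrow> ('i \<Rightarrow> real) \<Rightarrow> (('i \<Rightarrow> real) \<Rightarrow> real) \<Rightarrow> ennreal" where
  "risk P J t \<rho> h = (\<integral>\<^sup>+x. \<integral>\<^sup>+w. ennreal ((x t - h (observe J \<rho> x w))\<^sup>2) \<partial>noise J \<partial>P)"

definition min_risk :: "('i \<Rightarrow> real) measure \<Rightarrow> 'i set \<Rightarrow> 'i \<Rightarrow> ('i \<Rightarrow> real) \<Rightarrow> ennreal" where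
  "min_risk P J t \<rho> = (INF h\<in>borel_measurable (PiM J (\<lambda>_. borel)). risk P J t \<rho> h)"

lemma sets_noise [measurable_cong, simp]: "sets (noise J) = sets (PiM J (\<lambda>_. borel))"
  unfolding noise_def by (rule sets_PiM_cong) simp_all

lemma prob_space_noise: "prob_space (noise J)"
  unfolding noise_def by (intro prob_space_PiM prob_space_gauss)

lemma observe_cong: "(\<And>j. j \<in> J \<Longrightarrow> \<rho> j = \<rho>' j) \<Longrightarrow> observe J \<rho> = observe J \<rho>'"
  unfolding observe_def by (intro ext restrict_ext) auto

lemma min_risk_cong: "(\<And>j. j \<in> J \<Longrightarrow> \<rho> j = \<rho>' j) \<Longrightarrow> min_risk P J t \<rho> = min_risk P J t \<rho>'"
  unfolding min_risk_def risk_def by (simp cong: observe_cong)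

lemma measurable_observe [measurable (raw)]:
  assumes [measurable]: "f \<in> N \<rightarrow>\<^sub>M PiM J (\<lambda>_. borel)" "g \<in> N \<rightarrow>\<^sub>M PiM J (\<lambda>_. borel)"
  shows "(\<lambda>\<omega>. observe J \<rho> (f \<omega>) (g \<omega>)) \<in> N \<rightarrow>\<^sub>M PiM J (\<lambda>_. borel)"
  unfolding observe_def by measurable

lemma measurable_fun_upd_PiM:
  assumes "k \<in> J" "f \<in> N \<rightarrow>\<^sub>M PiM J (\<lambda>_. borel)" "g \<in> borel_measurable N"
  shows "(\<lambda>\<omega>. (f \<omega>)(k := g \<omega> :: real)) \<in> N \<rightarrow>\<^sub>M PiM J (\<lambda>_. borel)"
  using assms by (intro measurable_fun_upd[where J = J]) auto

text \<open>Fubini freezes all coordinates other than \<open>k\<close>; what remains is the planar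
  reflection acting on the pair \<open>(w k, u)\<close>.\<close>

lemma nn_integral_noise_rotate:
  fixes F :: "('i \<Rightarrow> real) \<Rightarrow> real \<Rightarrow> ennreal"
  assumes J: "finite J" "k \<in> J"
    and F [measurable]: "case_prod F \<in> borel_measurable (PiM J (\<lambda>_. borel) \<Otimes>\<^sub>M borel)"
    and ab: "a\<^sup>2 + b\<^sup>2 = 1" "a \<noteq> 0"
  shows "(\<integral>\<^sup>+w. \<integral>\<^sup>+u. F (w(k := a * w k + b * u)) (b * w k - a * u) \<partial>gauss \<partial>noise J) =
         (\<integral>\<^sup>+w. \<integral>\<^sup>+u. F w u \<partial>gauss \<partial>noise J)"
proof -
  interpret G: prob_space gauss by (rule prob_space_gauss)
  interpret product_sigma_finite "\<lambda>_. gauss" ..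
  define I where "I = J - {k}"
  have I: "finite I" "k \<notin> I" "J = insert k I"
    using J by (auto simp: I_def)
  note [measurable (raw)] = measurable_fun_upd_PiM[OF J(2)]
  have split: "(\<integral>\<^sup>+w. f w \<partial>noise J) = (\<integral>\<^sup>+x. \<integral>\<^sup>+p. f (x(k := p)) \<partial>gauss \<partial>PiM I (\<lambda>_. gauss))"
    if [measurable]: "f \<in> borel_measurable (PiM J (\<lambda>_. borel))" for f
    using product_nn_integral_insert[OF I(1,2), of f] measurable_cong_sets[OF sets_noise[of J] refl] that
    unfolding noise_def I(3) by simp
  have "(\<integral>\<^sup>+w. \<integral>\<^sup>+u. F (w(k := a * w k + b * u)) (b * w k - a * u) \<partial>gauss \<partial>noise J) =
    (\<integral>\<^sup>+x. \<integral>\<^sup>+p. \<integral>\<^sup>+u. F (x(k := a * p + b * u)) (b * p - a * u) \<partial>gauss \<partial>gauss \<partial>PiM I (\<lambda>_. gauss))"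
    using J by (subst split) simp_all
  also have "\<dots> = (\<integral>\<^sup>+x. \<integral>\<^sup>+p. \<integral>\<^sup>+u. F (x(k := p)) u \<partial>gauss \<partial>gauss \<partial>PiM I (\<lambda>_. gauss))"
  proof (rule nn_integral_cong)
    fix x assume "x \<in> space (PiM I (\<lambda>_. gauss))"
    then have x: "x \<in> space (PiM I (\<lambda>_. borel))"
      by (simp add: space_PiM)
    have [measurable]: "(\<lambda>p. x(k := p)) \<in> borel \<rightarrow>\<^sub>M PiM J (\<lambda>_. borel)"
      using I x by (intro measurable_fun_upd[where J = I] measurable_const) auto
    show "(\<integral>\<^sup>+p. \<integral>\<^sup>+u. F (x(k := a * p + b * u)) (b * p - a * u) \<partial>gauss \<partial>gauss) =
      (\<integral>\<^sup>+p. \<integral>\<^sup>+u. F (x(k := p)) u \<partial>gauss \<partial>gauss)"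
      using nn_integral_gauss_rotate[where F = "\<lambda>p. F (x(k := p))" and a = a and b = b] ab by simp
  qed
  also have "\<dots> = (\<integral>\<^sup>+w. \<integral>\<^sup>+u. F w u \<partial>gauss \<partial>noise J)"
    by (subst split) simp_all
  finally show ?thesis .
qed

section \<open>Comparison of Bayes risks under different noise variances\<close>

locale signal = prob_space P for P :: "('i \<Rightarrow> real) measure" +
  fixes J :: "'i set" and t :: 'i
  assumes sets_P [measurable_cong]: "sets P = sets (PiM J (\<lambda>_. borel))"
    and finite_J: "finite J" and t_in_J [simp]: "t \<in> J"
begin

text \<open>For each fixed \<open>u\<close> the section of \<open>H\<close> is an ordinary
  estimator, whose risk is at least the infimum. Integrating over \<open>u\<close> and exchanging
  the integrals gives the claim.\<close>

lemma min_risk_le_randomised: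
  assumes H [measurable]: "case_prod H \<in> borel_measurable (PiM J (\<lambda>_. borel) \<Otimes>\<^sub>M borel)"
  shows "min_risk P J t \<rho> \<le>
    (\<integral>\<^sup>+x. \<integral>\<^sup>+w. \<integral>\<^sup>+u. ennreal ((x t - H (observe J \<rho> x w) u)\<^sup>2) \<partial>gauss \<partial>noise J \<partial>P)"
proof -
  interpret G: prob_space gauss by (rule prob_space_gauss)
  interpret N: prob_space "noise J" by (rule prob_space_noise)
  interpret NG: pair_sigma_finite "noise J" gauss ..
  interpret PG: pair_sigma_finite P gauss ..
  have "min_risk P J t \<rho> = (\<integral>\<^sup>+u. min_risk P J t \<rho> \<partial>gauss)"
    by (simp add: G.emeasure_space_1[simplified])
  also have "\<dots> \<le> (\<integral>\<^sup>+u. risk P J t \<rho> (\<lambda>y. H y u) \<partial>gauss)"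
    unfolding min_risk_def by (intro nn_integral_mono INF_lower) measurable
  also have "\<dots> = (\<integral>\<^sup>+u. \<integral>\<^sup>+x. \<integral>\<^sup>+w. ennreal ((x t - H (observe J \<rho> x w) u)\<^sup>2) \<partial>noise J \<partial>P \<partial>gauss)"
    by (simp add: risk_def)
  also have "\<dots> = (\<integral>\<^sup>+x. \<integral>\<^sup>+u. \<integral>\<^sup>+w. ennreal ((x t - H (observe J \<rho> x w) u)\<^sup>2) \<partial>noise J \<partial>gauss \<partial>P)"
    by (rule PG.Fubini') measurable
  also have "\<dots> = (\<integral>\<^sup>+x. \<integral>\<^sup>+w. \<integral>\<^sup>+u. ennreal ((x t - H (observe J \<rho> x w) u)\<^sup>2) \<partial>gauss \<partial>noise J \<partial>P)"
  proof (rule nn_integral_cong)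
    fix x assume "x \<in> space P"
    then have [measurable]: "x \<in> space (PiM J (\<lambda>_. borel))"
      using sets_eq_imp_space_eq[OF sets_P] by simp
    show "(\<integral>\<^sup>+u. \<integral>\<^sup>+w. ennreal ((x t - H (observe J \<rho> x w) u)\<^sup>2) \<partial>noise J \<partial>gauss) =
      (\<integral>\<^sup>+w. \<integral>\<^sup>+u. ennreal ((x t - H (observe J \<rho> x w) u)\<^sup>2) \<partial>gauss \<partial>noise J)"
      by (rule NG.Fubini') measurable
  qed
  finally show ?thesis .
qed

text \<open>
  An observation with noise variance \<open>\<tau>1\<close> can be split, with the help of an auxiliary Gaussian
  \<open>u\<close>, into two observations with independent noises of variances \<open>\<tau>2\<close> and
  \<open>\<tau>1 * \<tau>2 / (\<tau>2 - \<tau>1)\<close>. Feeding the first to \<open>m\<close> and averaging the result with the second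
  gives the bound below.
\<close>

lemma min_risk_le_split:
  assumes k: "k \<in> J" and c: "k = t \<or> c = 0" and \<tau>: "0 < \<tau>1" "\<tau>1 < \<tau>2"
    and m [measurable]: "m \<in> borel_measurable (PiM J (\<lambda>_. borel))"
  shows "min_risk P J t (\<rho>(k := \<tau>1)) \<le>
    ennreal ((1 - c)\<^sup>2) * risk P J t (\<rho>(k := \<tau>2)) m + ennreal (c\<^sup>2 * (\<tau>1 * \<tau>2 / (\<tau>2 - \<tau>1)))"
proof -
  interpret G: prob_space gauss by (rule prob_space_gauss)
  interpret N: prob_space "noise J" by (rule prob_space_noise)
  \<comment> \<open>These are chosen so that \<open>sqrt \<tau>2 * (a * w k + b * u)\<close> is the
    noise \<open>sqrt \<tau>1 * w k + d * u\<close> of the degraded observation, while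
    \<open>s * (b * w k - a * u)\<close> is the noise of the second one. The two bracketed variables
    are orthogonal, and \<open>1 / s^2 = 1 / \<tau>1 - 1 / \<tau>2\<close>.\<close>
  define a b s d where "a = sqrt (\<tau>1 / \<tau>2)" and "b = sqrt ((\<tau>2 - \<tau>1) / \<tau>2)"
    and "s = sqrt (\<tau>1 * \<tau>2 / (\<tau>2 - \<tau>1))" and "d = sqrt (\<tau>2 - \<tau>1)"
  have ab: "a\<^sup>2 + b\<^sup>2 = 1" "a \<noteq> 0"
    using \<tau> by (auto simp: a_def b_def field_simps)
  have d: "d > 0" using \<tau> by (simp add: d_def)
  have id: "sqrt \<tau>2 * a = sqrt \<tau>1" "sqrt \<tau>2 * b = d" "s * b = sqrt \<tau>1" "s * a = \<tau>1 / d"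
    using \<tau> by (simp_all add: a_def b_def s_def d_def real_sqrt_mult real_sqrt_divide field_simps)
  have s2: "s\<^sup>2 = \<tau>1 * \<tau>2 / (\<tau>2 - \<tau>1)"
    using \<tau> by (simp add: s_def)
  note k [simp]
  define H where "H y u = (1 - c) * m (y(k := y k + d * u)) + c * (y t - \<tau>1 / d * u)" for y u
  have "(\<lambda>(y, u). y(k := y k + d * u)) \<in> (PiM J (\<lambda>_. borel) \<Otimes>\<^sub>M borel) \<rightarrow>\<^sub>M PiM J (\<lambda>_. borel)"
    unfolding split_beta by (intro measurable_fun_upd_PiM[OF k]) measurable
  from measurable_compose[OF this m]
  have [measurable]: "(\<lambda>(y, u). m (y(k := y k + d * u))) \<in> borel_measurable (PiM J (\<lambda>_. borel) \<Otimes>\<^sub>M borel)"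
    by (simp add: split_beta)
  have [measurable]: "case_prod H \<in> borel_measurable (PiM J (\<lambda>_. borel) \<Otimes>\<^sub>M borel)"
    unfolding H_def by measurable
  define A where "A x w = x t - m (observe J (\<rho>(k := \<tau>2)) x w)" for x w
  have [measurable]: "case_prod A \<in> borel_measurable (PiM J (\<lambda>_. borel) \<Otimes>\<^sub>M PiM J (\<lambda>_. borel))"
    unfolding A_def by measurable
  \<comment> \<open>The error depends on \<open>w k\<close> and \<open>u\<close> only through the
    reflected pair, one component entering through \<open>A\<close> and the other linearly.\<close>
  have err: "x t - H (observe J (\<rho>(k := \<tau>1)) x w) u =
      (1 - c) * A x (w(k := a * w k + b * u)) + (- (c * s)) * (b * w k - a * u)" for x w u
  proof -
    have "sqrt \<tau>2 * (a * w k + b * u) = sqrt \<tau>1 * w k + d * u"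
      by (metis id(1,2) distrib_left mult.assoc)
    then have 1: "(observe J (\<rho>(k := \<tau>1)) x w)(k := observe J (\<rho>(k := \<tau>1)) x w k + d * u) =
        observe J (\<rho>(k := \<tau>2)) x (w(k := a * w k + b * u))"
      using k by (auto simp: observe_def fun_eq_iff)
    \<comment> \<open>Either \<open>k = t\<close>, and the observation of \<open>t\<close> has noise
      variance \<open>\<tau>1\<close>, or \<open>c = 0\<close> and both sides vanish.\<close>
    have "c * (observe J (\<rho>(k := \<tau>1)) x w t - \<tau>1 / d * u) = c * x t + c * ((s * b) * w k - (s * a) * u)"
      using c t_in_J unfolding id by (auto simp: observe_def algebra_simps)
    then show ?thesis
      unfolding H_def 1 A_def by (simp add: algebra_simps)
  qed
  have "min_risk P J t (\<rho>(k := \<tau>1)) \<le>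
    (\<integral>\<^sup>+x. \<integral>\<^sup>+w. \<integral>\<^sup>+u. ennreal ((x t - H (observe J (\<rho>(k := \<tau>1)) x w) u)\<^sup>2) \<partial>gauss \<partial>noise J \<partial>P)"
    by (rule min_risk_le_randomised) measurable
  also have "\<dots> = (\<integral>\<^sup>+x. \<integral>\<^sup>+w. \<integral>\<^sup>+u. ennreal (((1 - c) * A x w + (- (c * s)) * u)\<^sup>2) \<partial>gauss \<partial>noise J \<partial>P)"
  proof (rule nn_integral_cong)
    fix x assume "x \<in> space P"
    then have [measurable]: "x \<in> space (PiM J (\<lambda>_. borel))"
      using sets_eq_imp_space_eq[OF sets_P] by simp
    have [measurable]: "A x \<in> borel_measurable (PiM J (\<lambda>_. borel))"
      by measurable
    show "(\<integral>\<^sup>+w. \<integral>\<^sup>+u. ennreal ((x t - H (observe J (\<rho>(k := \<tau>1)) x w) u)\<^sup>2) \<partial>gauss \<partial>noise J) =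
      (\<integral>\<^sup>+w. \<integral>\<^sup>+u. ennreal (((1 - c) * A x w + (- (c * s)) * u)\<^sup>2) \<partial>gauss \<partial>noise J)"
      unfolding err
      by (rule nn_integral_noise_rotate[OF finite_J k _ ab,
            where F = "\<lambda>w u. ennreal (((1 - c) * A x w + (- (c * s)) * u)\<^sup>2)"]) measurable
  qed
  \<comment> \<open>After the reflection \<open>u\<close> is independent of the error of
    \<open>m\<close>, so the two contributions add without a cross term.\<close>
  also have "\<dots> = (\<integral>\<^sup>+x. \<integral>\<^sup>+w. ennreal ((1 - c)\<^sup>2) * ennreal ((A x w)\<^sup>2) + ennreal (c\<^sup>2 * s\<^sup>2) \<partial>noise J \<partial>P)"
    unfolding nn_integral_gauss_square
    by (simp add: power_mult_distrib ennreal_mult)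
  also have "\<dots> = (\<integral>\<^sup>+x. ennreal ((1 - c)\<^sup>2) * (\<integral>\<^sup>+w. ennreal ((A x w)\<^sup>2) \<partial>noise J) + ennreal (c\<^sup>2 * s\<^sup>2) \<partial>P)"
  proof (rule nn_integral_cong)
    fix x assume "x \<in> space P"
    then have [measurable]: "x \<in> space (PiM J (\<lambda>_. borel))"
      using sets_eq_imp_space_eq[OF sets_P] by simp
    have [measurable]: "A x \<in> borel_measurable (PiM J (\<lambda>_. borel))"
      by measurable
    show "(\<integral>\<^sup>+w. ennreal ((1 - c)\<^sup>2) * ennreal ((A x w)\<^sup>2) + ennreal (c\<^sup>2 * s\<^sup>2) \<partial>noise J) =
      ennreal ((1 - c)\<^sup>2) * (\<integral>\<^sup>+w. ennreal ((A x w)\<^sup>2) \<partial>noise J) + ennreal (c\<^sup>2 * s\<^sup>2)"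
      by (simp add: nn_integral_add nn_integral_cmult N.emeasure_space_1)
  qed
  also have "\<dots> = ennreal ((1 - c)\<^sup>2) * risk P J t (\<rho>(k := \<tau>2)) m + ennreal (c\<^sup>2 * s\<^sup>2)"
    unfolding risk_def A_def[symmetric]
    by (simp add: nn_integral_add nn_integral_cmult emeasure_space_1)
  finally show ?thesis unfolding s2 .
qed

text \<open>The split with weight \<open>c = 0\<close> merely adds noise to coordinate
  \<open>k\<close> and then applies an estimator meant for variance \<open>\<tau>2\<close>; this is
  allowed for any \<open>k\<close>, not only the target.\<close>

lemma min_risk_mono_coord:
  assumes k: "k \<in> J" and \<tau>: "0 < \<tau>1" "\<tau>1 \<le> \<tau>2"
  shows "min_risk P J t (\<rho>(k := \<tau>1)) \<le> min_risk P J t (\<rho>(k := \<tau>2))"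
proof (cases "\<tau>1 = \<tau>2")
  case False
  then have "min_risk P J t (\<rho>(k := \<tau>1)) \<le> risk P J t (\<rho>(k := \<tau>2)) m"
    if "m \<in> borel_measurable (PiM J (\<lambda>_. borel))" for m
    using min_risk_le_split[OF k _ \<tau>(1) _ that, of 0 \<tau>2 \<rho>] \<tau> by simp
  then show ?thesis
    unfolding min_risk_def[of P J t "\<rho>(k := \<tau>2)"] by (rule INF_greatest)
qed simp

lemma min_risk_mono:
  assumes \<rho>: "\<And>j. j \<in> J \<Longrightarrow> 0 < \<rho> j" "\<And>j. j \<in> J \<Longrightarrow> \<rho> j \<le> \<rho>' j"
  shows "min_risk P J t \<rho> \<le> min_risk P J t \<rho>'"
proof -
  \<comment> \<open>Hybrid argument: the coordinates pass from the larger to the smaller variance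
    one at a time.\<close>
  have "min_risk P J t (\<lambda>j. if j \<in> S then \<rho> j else \<rho>' j) \<le> min_risk P J t \<rho>'" if "S \<subseteq> J" for S
    using finite_subset[OF that finite_J] that
  proof (induction S rule: finite_induct)
    case (insert k S)
    define \<xi> where "\<xi> = (\<lambda>j. if j \<in> S then \<rho> j else \<rho>' j)"
    have "(\<lambda>j. if j \<in> insert k S then \<rho> j else \<rho>' j) = \<xi>(k := \<rho> k)" "\<xi> = \<xi>(k := \<rho>' k)"
      using insert.hyps by (auto simp: \<xi>_def)
    then have "min_risk P J t (\<lambda>j. if j \<in> insert k S then \<rho> j else \<rho>' j) \<le> min_risk P J t \<xi>"
      using min_risk_mono_coord[of k "\<rho> k" "\<rho>' k" \<xi>] insert.prems \<rho> by auto
    also have "\<dots> \<le> min_risk P J t \<rho>'"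
      using insert by (auto simp: \<xi>_def)
    finally show ?case .
  qed simp
  from this[of J] show ?thesis
    by (subst min_risk_cong[of J \<rho> "\<lambda>j. if j \<in> J then \<rho> j else \<rho>' j"]) auto
qed

lemma nn_integral_noise_component:
  assumes [measurable]: "f \<in> borel_measurable borel"
  shows "(\<integral>\<^sup>+w. f (w t) \<partial>noise J) = (\<integral>\<^sup>+u. f u \<partial>gauss)"
proof -
  have "distr (noise J) gauss (\<lambda>w. w t) = gauss"
    unfolding noise_def by (intro distr_PiM_component prob_space_gauss t_in_J)
  then have "(\<integral>\<^sup>+u. f u \<partial>gauss) = (\<integral>\<^sup>+u. f u \<partial>distr (noise J) gauss (\<lambda>w. w t))"
    by simp
  also have "\<dots> = (\<integral>\<^sup>+w. f (w t) \<partial>noise J)"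
    by (rule nn_integral_distr) measurable
  finally show ?thesis by simp
qed

text \<open>The competitor is the affine estimator \<open>(1 - c) * \<mu> + c * y t\<close>, which
  looks at the current observation only. The constants stay free here; \<open>\<mu>\<close> will be
  the mean and \<open>c\<close> the optimal weight.\<close>

lemma min_risk_le_linear:
  assumes "0 \<le> \<rho> t"
  shows "min_risk P J t \<rho> \<le>
    ennreal ((1 - c)\<^sup>2) * (\<integral>\<^sup>+x. ennreal ((x t - \<mu>)\<^sup>2) \<partial>P) + ennreal (c\<^sup>2 * \<rho> t)"
proof -
  have err: "x t - ((1 - c) * \<mu> + c * observe J \<rho> x w t) =
      (1 - c) * (x t - \<mu>) + (- (c * sqrt (\<rho> t))) * w t" for x w
    by (simp add: observe_def algebra_simps)
  have "min_risk P J t \<rho> \<le> risk P J t \<rho> (\<lambda>y. (1 - c) * \<mu> + c * y t)"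
    unfolding min_risk_def by (rule INF_lower) measurable
  also have "\<dots> = (\<integral>\<^sup>+x. \<integral>\<^sup>+u. ennreal (((1 - c) * (x t - \<mu>) + (- (c * sqrt (\<rho> t))) * u)\<^sup>2) \<partial>gauss \<partial>P)"
    unfolding risk_def err by (subst nn_integral_noise_component) auto
  also have "\<dots> = (\<integral>\<^sup>+x. ennreal ((1 - c)\<^sup>2) * ennreal ((x t - \<mu>)\<^sup>2) + ennreal (c\<^sup>2 * \<rho> t) \<partial>P)"
    unfolding nn_integral_gauss_square using assms
    by (simp add: power_mult_distrib ennreal_mult)
  also have "\<dots> = ennreal ((1 - c)\<^sup>2) * (\<integral>\<^sup>+x. ennreal ((x t - \<mu>)\<^sup>2) \<partial>P) + ennreal (c\<^sup>2 * \<rho> t)"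
    by (simp add: nn_integral_add nn_integral_cmult emeasure_space_1)
  finally show ?thesis .
qed

end

section \<open>Conditional expectation as the best estimator based on the observations\<close>

section \<open>Conditional expectation and mean-square error\<close>

text \<open>Doob-Dynkin factorisation, by induction over nonnegative measurable functions. In
  \<open>ennreal\<close> the supremum of the factors is measurable even off the range of
  \<open>f\<close>, where nothing is known about their convergence.\<close>

lemma vimage_algebra_factor_ennreal:
  fixes g :: "'a \<Rightarrow> ennreal"
  assumes f: "f \<in> \<Omega> \<rightarrow> space N" and g: "g \<in> borel_measurable (vimage_algebra \<Omega> f N)"
  shows "\<exists>h\<in>borel_measurable N. \<forall>\<omega>\<in>\<Omega>. g \<omega> = h (f \<omega>)"
  using g
proof (induction rule: borel_measurable_induct)
  case (cong u v)
  then show ?case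
    by (metis (no_types, lifting) space_vimage_algebra)
next
  case (set A)
  then obtain B where "B \<in> sets N" "A = f -` B \<inter> \<Omega>"
    using f by (auto simp: sets_vimage_algebra2)
  then show ?case
    by (intro bexI[of _ "indicator B"]) (auto simp: indicator_def)
next
  case (mult u c)
  then obtain h where "h \<in> borel_measurable N" "\<forall>\<omega>\<in>\<Omega>. u \<omega> = h (f \<omega>)" by blast
  then show ?case by (intro bexI[of _ "\<lambda>x. c * h x"]) simp_all
next
  case (add u v)
  then obtain h k where "h \<in> borel_measurable N" "\<forall>\<omega>\<in>\<Omega>. u \<omega> = h (f \<omega>)"
    "k \<in> borel_measurable N" "\<forall>\<omega>\<in>\<Omega>. v \<omega> = k (f \<omega>)" by blast
  then show ?case by (intro bexI[of _ "\<lambda>x. k x + h x"]) simp_all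
next
  case (seq U)
  then obtain h where "\<And>i. h i \<in> borel_measurable N" "\<And>i. \<forall>\<omega>\<in>\<Omega>. U i \<omega> = h i (f \<omega>)"
    by metis
  then show ?case
    by (intro bexI[of _ "\<lambda>x. SUP i. h i x"]) (simp_all add: image_comp)
qed

lemma vimage_algebra_factor_real:
  fixes g :: "'a \<Rightarrow> real"
  assumes f: "f \<in> \<Omega> \<rightarrow> space N" and g: "g \<in> borel_measurable (vimage_algebra \<Omega> f N)"
  shows "\<exists>h\<in>borel_measurable N. \<forall>\<omega>\<in>\<Omega>. g \<omega> = h (f \<omega>)"
proof -
  have "(\<lambda>\<omega>. ennreal (g \<omega>)) \<in> borel_measurable (vimage_algebra \<Omega> f N)"
    "(\<lambda>\<omega>. ennreal (- g \<omega>)) \<in> borel_measurable (vimage_algebra \<Omega> f N)"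
    using g by measurable
  from this[THEN vimage_algebra_factor_ennreal[OF f]]
  obtain h k where "h \<in> borel_measurable N" "k \<in> borel_measurable N"
    and hk: "\<forall>\<omega>\<in>\<Omega>. ennreal (g \<omega>) = h (f \<omega>)" "\<forall>\<omega>\<in>\<Omega>. ennreal (- g \<omega>) = k (f \<omega>)" by blast
  \<comment> \<open>\<open>ennreal\<close> sends negative numbers to 0, so these are the positive
    and negative parts.\<close>
  moreover have "g \<omega> = enn2real (ennreal (g \<omega>)) - enn2real (ennreal (- g \<omega>))" for \<omega>
    by (cases "g \<omega> \<ge> 0") (auto simp: ennreal_neg)
  then have "\<forall>\<omega>\<in>\<Omega>. g \<omega> = enn2real (h (f \<omega>)) - enn2real (k (f \<omega>))"
    using hk by metis
  ultimately show ?thesis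
    by (intro bexI[of _ "\<lambda>x. enn2real (h x) - enn2real (k x)"]) simp_all
qed

context finite_measure_subalgebra
begin

text \<open>Jensen's inequality for the square. It makes the cross term of the projection argument
  integrable.\<close>

lemma integrable_real_cond_exp_square:
  assumes "X \<in> borel_measurable M" "integrable M (\<lambda>\<omega>. (X \<omega>)\<^sup>2)"
  shows "integrable M (\<lambda>\<omega>. (real_cond_exp M F X \<omega>)\<^sup>2)"
proof (rule integrable_convex_cond_exp[where I = UNIV])
  show "integrable M X"
    using assms by (rule square_integrable_imp_integrable)
  show "convex_on UNIV (\<lambda>x :: real. x\<^sup>2)"
    by (rule convex_power2)
qed (use assms in simp_all)

text \<open>Orthogonal projection: \<open>E - Y\<close> is measurable with respect to
  \<open>F\<close>, hence orthogonal to \<open>X - E\<close>, and Pythagoras applies. An infinite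
  right-hand side is trivial.\<close>

lemma real_cond_exp_least_square:
  assumes [measurable]: "X \<in> borel_measurable M" and X2: "integrable M (\<lambda>\<omega>. (X \<omega>)\<^sup>2)"
    and Y: "Y \<in> borel_measurable F"
  shows "ennreal (\<integral>\<omega>. (X \<omega> - real_cond_exp M F X \<omega>)\<^sup>2 \<partial>M) \<le> (\<integral>\<^sup>+\<omega>. ennreal ((X \<omega> - Y \<omega>)\<^sup>2) \<partial>M)"
proof (cases "(\<integral>\<^sup>+\<omega>. ennreal ((X \<omega> - Y \<omega>)\<^sup>2) \<partial>M) = \<infinity>")
  case False
  have [measurable]: "Y \<in> borel_measurable M"
    by (rule measurable_from_subalg[OF subalg Y])
  have cs: "integrable M (\<lambda>\<omega>. f \<omega> * g \<omega>)"
    if [measurable]: "f \<in> borel_measurable M" "g \<in> borel_measurable M"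
      and "integrable M (\<lambda>\<omega>. (f \<omega>)\<^sup>2)" "integrable M (\<lambda>\<omega>. (g \<omega>)\<^sup>2)" for f g :: "'a \<Rightarrow> real"
  proof (rule Bochner_Integration.integrable_bound[OF Bochner_Integration.integrable_add[OF that(3,4)]])
    have "\<bar>a * b\<bar> \<le> a\<^sup>2 + b\<^sup>2" for a b :: real
      using sum_squares_bound[of "\<bar>a\<bar>" "\<bar>b\<bar>"] mult_nonneg_nonneg[OF abs_ge_zero[of a] abs_ge_zero[of b]]
      unfolding abs_mult power2_abs by linarith
    then show "AE \<omega> in M. norm (f \<omega> * g \<omega>) \<le> norm ((f \<omega>)\<^sup>2 + (g \<omega>)\<^sup>2)"
      by (simp add: sum_power2_ge_zero)
  qed measurable
  define E where "E = real_cond_exp M F X"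
  have [measurable]: "E \<in> borel_measurable M" and E_F: "E \<in> borel_measurable F"
    by (simp_all add: E_def)
  have E2: "integrable M (\<lambda>\<omega>. (E \<omega>)\<^sup>2)"
    unfolding E_def using assms by (intro integrable_real_cond_exp_square)
  have XY2: "integrable M (\<lambda>\<omega>. (X \<omega> - Y \<omega>)\<^sup>2)"
    using False by (intro integrableI_nonneg) (auto simp: less_top)
  have diff: "integrable M (\<lambda>\<omega>. (f \<omega> - g \<omega>)\<^sup>2)"
    if [measurable]: "f \<in> borel_measurable M" "g \<in> borel_measurable M"
      and "integrable M (\<lambda>\<omega>. (f \<omega>)\<^sup>2)" "integrable M (\<lambda>\<omega>. (g \<omega>)\<^sup>2)" for f g :: "'a \<Rightarrow> real"
  proof -
    have "integrable M (\<lambda>\<omega>. (f \<omega>)\<^sup>2 + (g \<omega>)\<^sup>2 - 2 * (f \<omega> * g \<omega>))"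
      by (intro Bochner_Integration.integrable_diff Bochner_Integration.integrable_add
          integrable_mult_right cs that)
    then show ?thesis by (simp add: power2_diff mult.assoc)
  qed
  \<comment> \<open>A finite risk forces this, since \<open>Y = X - (X - Y)\<close>.\<close>
  have Y2: "integrable M (\<lambda>\<omega>. (Y \<omega>)\<^sup>2)"
    using diff[OF _ _ X2 XY2] by simp
  define D where "D \<omega> = E \<omega> - Y \<omega>" for \<omega>
  have [measurable]: "D \<in> borel_measurable M" and D_F: "D \<in> borel_measurable F"
    using E_F Y unfolding D_def[abs_def] by simp_all
  have D2: "integrable M (\<lambda>\<omega>. (D \<omega>)\<^sup>2)"
    unfolding D_def by (intro diff E2 Y2) measurable
  have XE2: "integrable M (\<lambda>\<omega>. (X \<omega> - E \<omega>)\<^sup>2)"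
    by (intro diff X2 E2) measurable
  have DX: "integrable M (\<lambda>\<omega>. D \<omega> * X \<omega>)" and DE: "integrable M (\<lambda>\<omega>. D \<omega> * E \<omega>)"
    by (intro cs D2 X2 E2; measurable)+
  have "(\<integral>\<omega>. D \<omega> * E \<omega> \<partial>M) = (\<integral>\<omega>. D \<omega> * X \<omega> \<partial>M)"
    unfolding E_def by (intro real_cond_exp_intg(2) DX D_F) measurable
  then have orth: "(\<integral>\<omega>. D \<omega> * X \<omega> - D \<omega> * E \<omega> \<partial>M) = 0"
    using DX DE by simp
  have "(\<integral>\<omega>. (X \<omega> - Y \<omega>)\<^sup>2 \<partial>M) =
      (\<integral>\<omega>. (X \<omega> - E \<omega>)\<^sup>2 + 2 * (D \<omega> * X \<omega> - D \<omega> * E \<omega>) + (D \<omega>)\<^sup>2 \<partial>M)"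
    by (intro Bochner_Integration.integral_cong refl) (simp add: D_def power2_eq_square algebra_simps)
  also have "\<dots> = (\<integral>\<omega>. (X \<omega> - E \<omega>)\<^sup>2 \<partial>M) + 2 * (\<integral>\<omega>. D \<omega> * X \<omega> - D \<omega> * E \<omega> \<partial>M) + (\<integral>\<omega>. (D \<omega>)\<^sup>2 \<partial>M)"
    using XE2 DX DE D2 by simp
  finally have "(\<integral>\<omega>. (X \<omega> - E \<omega>)\<^sup>2 \<partial>M) \<le> (\<integral>\<omega>. (X \<omega> - Y \<omega>)\<^sup>2 \<partial>M)"
    by (simp add: orth)
  then show ?thesis
    using XY2 by (simp add: E_def nn_integral_eq_integral ennreal_leI)
qed simp

end

context prob_space
begin

text \<open>Link between conditional expectation and estimators: a function of the observations is
  measurable for the algebra they generate, and conversely the conditional expectation factors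
  through the observations, so the bound is attained.\<close>

lemma
  fixes X :: "'a \<Rightarrow> real" and z :: "'a \<Rightarrow> real" and Z :: "nat \<Rightarrow> 'a \<Rightarrow> real"
  assumes X [measurable]: "X \<in> borel_measurable M" and X2: "integrable M (\<lambda>\<omega>. (X \<omega>)\<^sup>2)"
    and z [measurable]: "z \<in> borel_measurable M"
    and Z [measurable]: "\<And>j. j \<in> J \<Longrightarrow> Z j \<in> borel_measurable M"
  shows mmse_le: "h \<in> borel_measurable (borel \<Otimes>\<^sub>M PiM J (\<lambda>_. borel)) \<Longrightarrow>
      ennreal (mmse M X z J Z) \<le> (\<integral>\<^sup>+\<omega>. ennreal ((X \<omega> - h (z \<omega>, \<lambda>j\<in>J. Z j \<omega>))\<^sup>2) \<partial>M)"
    and mmse_attained: "\<exists>h\<in>borel_measurable (borel \<Otimes>\<^sub>M PiM J (\<lambda>_. borel)).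
      ennreal (mmse M X z J Z) = (\<integral>\<^sup>+\<omega>. ennreal ((X \<omega> - h (z \<omega>, \<lambda>j\<in>J. Z j \<omega>))\<^sup>2) \<partial>M)"
proof -
  define N :: "(real \<times> (nat \<Rightarrow> real)) measure" where "N = borel \<Otimes>\<^sub>M PiM J (\<lambda>_. borel)"
  define f where "f \<omega> = (z \<omega>, \<lambda>j\<in>J. Z j \<omega>)" for \<omega>
  have f [measurable]: "f \<in> M \<rightarrow>\<^sub>M N"
    unfolding f_def N_def by measurable
  then have f_space: "f \<in> space M \<rightarrow> space N"
    using measurable_space[OF f] by blast
  define F where "F = vimage_algebra (space M) f N"
  have f_F: "f \<in> F \<rightarrow>\<^sub>M N"
    unfolding F_def using f_space by (intro measurable_vimage_algebra1)
  have "subalgebra M F"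
    unfolding subalgebra_def F_def using f f_space
    by (auto simp: sets_vimage_algebra2 measurable_sets)
  then interpret finite_measure_subalgebra M F by unfold_locales
  have mmse: "mmse M X z J Z = (\<integral>\<omega>. (X \<omega> - real_cond_exp M F X \<omega>)\<^sup>2 \<partial>M)"
    by (simp add: mmse_def F_def f_def[abs_def] N_def)
  show "ennreal (mmse M X z J Z) \<le> (\<integral>\<^sup>+\<omega>. ennreal ((X \<omega> - h (z \<omega>, \<lambda>j\<in>J. Z j \<omega>))\<^sup>2) \<partial>M)"
    if "h \<in> borel_measurable (borel \<Otimes>\<^sub>M PiM J (\<lambda>_. borel))"
    unfolding mmse f_def[symmetric]
    using that by (intro real_cond_exp_least_square X X2 measurable_compose[OF f_F]) (simp add: N_def)
  have "real_cond_exp M F X \<in> borel_measurable (vimage_algebra (space M) f N)"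
    unfolding F_def[symmetric] by simp
  from vimage_algebra_factor_real[OF f_space this]
  obtain h where h [measurable]: "h \<in> borel_measurable N"
    and h_eq: "\<And>\<omega>. \<omega> \<in> space M \<Longrightarrow> real_cond_exp M F X \<omega> = h (f \<omega>)" by blast
  have hf: "integrable M (\<lambda>\<omega>. (h (f \<omega>))\<^sup>2)"
    using integrable_real_cond_exp_square[OF X X2] by (simp add: h_eq cong: Bochner_Integration.integrable_cong)
  have "integrable M (\<lambda>\<omega>. (X \<omega> - h (f \<omega>))\<^sup>2)"
  proof (rule Bochner_Integration.integrable_bound)
    show "integrable M (\<lambda>\<omega>. 2 * (X \<omega>)\<^sup>2 + 2 * (h (f \<omega>))\<^sup>2)"
      using X2 hf by simp
    have "(a - b)\<^sup>2 \<le> 2 * a\<^sup>2 + 2 * b\<^sup>2" for a b :: real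
      using zero_le_power2[of "a + b"] by (simp add: power2_sum power2_diff)
    then show "AE \<omega> in M. norm ((X \<omega> - h (f \<omega>))\<^sup>2) \<le> norm (2 * (X \<omega>)\<^sup>2 + 2 * (h (f \<omega>))\<^sup>2)"
      by simp
  qed measurable
  then have "ennreal (mmse M X z J Z) = (\<integral>\<^sup>+\<omega>. ennreal ((X \<omega> - h (f \<omega>))\<^sup>2) \<partial>M)"
    unfolding mmse by (simp add: h_eq nn_integral_eq_integral cong: Bochner_Integration.integral_cong)
  then show "\<exists>h\<in>borel_measurable (borel \<Otimes>\<^sub>M PiM J (\<lambda>_. borel)).
      ennreal (mmse M X z J Z) = (\<integral>\<^sup>+\<omega>. ennreal ((X \<omega> - h (z \<omega>, \<lambda>j\<in>J. Z j \<omega>))\<^sup>2) \<partial>M)"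
    using h unfolding N_def f_def by blast
qed

end

section \<open>Mean-square errors of the process as Bayes risks of windows of rounds\<close>

section \<open>Stationary signals\<close>

text \<open>The weight \<open>a / (a + b)\<close> minimises the quadratic in the weight, and the
  minimum is the reciprocal of \<open>1/a + 1/b\<close>. The form without reciprocals admits
  \<open>a = 0\<close>.\<close>

lemma weighted_bound_optimum:
  fixes a b :: real
  assumes "0 \<le> a" "0 < b"
  shows "(1 - a / (a + b))\<^sup>2 * a + (a / (a + b))\<^sup>2 * b = a * b / (a + b)"
proof -
  define s where "s = a + b"
  have s: "s \<noteq> 0" using assms by (simp add: s_def)
  then have "1 - a / s = b / s" by (simp add: s_def field_simps)
  then have "(1 - a / s)\<^sup>2 * a + (a / s)\<^sup>2 * b = (b\<^sup>2 * a + a\<^sup>2 * b) / s\<^sup>2"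
    by (simp add: power_divide add_divide_distrib)
  also have "b\<^sup>2 * a + a\<^sup>2 * b = a * b * s"
    by (simp add: s_def power2_eq_square algebra_simps)
  also have "a * b * s / s\<^sup>2 = a * b / s"
    using s by (simp add: power2_eq_square)
  finally show ?thesis by (simp add: s_def)
qed

locale stationary_signal = prob_space M for M :: "'a measure" +
  fixes x w :: "nat \<Rightarrow> 'a \<Rightarrow> real" and T :: nat
  assumes x_meas: "\<And>t. t \<in> {1..T} \<Longrightarrow> x t \<in> borel_measurable M"
    and x_var: "\<And>t. t \<in> {1..T} \<Longrightarrow> integrable M (\<lambda>\<omega>. (x t \<omega>)\<^sup>2)"
    and w_normal: "\<And>t. t \<in> {1..T} \<Longrightarrow> distributed M lborel (w t) std_normal_density"
    and w_indep: "indep_vars (\<lambda>_. borel) w {1..T}"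
    and xw_indep: "indep_var
          (PiM {1..T} (\<lambda>_. borel)) (\<lambda>\<omega>. \<lambda>t\<in>{1..T}. x t \<omega>)
          (PiM {1..T} (\<lambda>_. borel)) (\<lambda>\<omega>. \<lambda>t\<in>{1..T}. w t \<omega>)"
    and x_stat: "strictly_stationary M T x"
begin

definition signal_law :: "nat \<Rightarrow> (nat \<Rightarrow> real) measure" where
  "signal_law t = distr M (PiM {1..t} (\<lambda>_. borel)) (\<lambda>\<omega>. \<lambda>j\<in>{1..t}. x j \<omega>)"

lemma w_meas: "t \<in> {1..T} \<Longrightarrow> w t \<in> borel_measurable M"
  using w_indep unfolding indep_vars_def by auto

lemma signal_signal_law:
  assumes "1 \<le> t" "t \<le> T"
  shows "signal (signal_law t) {1..t} t"
proof -
  have "(\<lambda>\<omega>. \<lambda>j\<in>{1..t}. x j \<omega>) \<in> M \<rightarrow>\<^sub>M PiM {1..t} (\<lambda>_. borel)"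
    using assms by (intro measurable_restrict x_meas) auto
  then show ?thesis
    unfolding signal_def signal_axioms_def signal_law_def
    using assms by (auto intro!: prob_space_distr)
qed

lemma distr_w: "distr M borel (w t) = gauss" if "t \<in> {1..T}"
proof -
  have "distr M lborel (w t) = gauss"
    using distributed_distr_eq_density[OF w_normal[OF that]] by (simp add: gauss_def)
  then show ?thesis
    by (metis distr_cong sets_lborel)
qed

text \<open>Stationarity gives a shifted signal window the law of the initial one, and i.i.d. noise
  does the same for the noise window. Independence is inherited because both windows are images of
  the full vectors under the same map \<open>r\<close>.\<close>

lemma indep_signal_noise:
  assumes t: "1 \<le> t" "t + h \<le> T"
  shows "distr M (PiM {1..t} (\<lambda>_. borel) \<Otimes>\<^sub>M PiM {1..t} (\<lambda>_. borel))
      (\<lambda>\<omega>. (\<lambda>j\<in>{1..t}. x (j + h) \<omega>, \<lambda>j\<in>{1..t}. w (j + h) \<omega>)) =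
    signal_law t \<Otimes>\<^sub>M noise {1..t}"
proof -
  let ?P = "\<lambda>n. PiM {1..n} (\<lambda>_. borel :: real measure)"
  define r :: "(nat \<Rightarrow> real) \<Rightarrow> nat \<Rightarrow> real" where "r y = (\<lambda>j\<in>{1..t}. y (j + h))" for y
  have r: "r \<in> ?P T \<rightarrow>\<^sub>M ?P t"
    unfolding r_def using t by (intro measurable_restrict measurable_component_singleton) auto
  have rr: "r \<circ> (\<lambda>\<omega>. \<lambda>j\<in>{1..T}. z j \<omega>) = (\<lambda>\<omega>. \<lambda>j\<in>{1..t}. z (j + h) \<omega>)"
    for z :: "nat \<Rightarrow> 'a \<Rightarrow> real"
    using t by (auto simp: r_def fun_eq_iff)
  have "indep_var (?P t) (\<lambda>\<omega>. \<lambda>j\<in>{1..t}. x (j + h) \<omega>) (?P t) (\<lambda>\<omega>. \<lambda>j\<in>{1..t}. w (j + h) \<omega>)"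
    using indep_var_compose[OF xw_indep r r] unfolding rr .
  then have *: "distr M (?P t) (\<lambda>\<omega>. \<lambda>j\<in>{1..t}. x (j + h) \<omega>) \<Otimes>\<^sub>M distr M (?P t) (\<lambda>\<omega>. \<lambda>j\<in>{1..t}. w (j + h) \<omega>) =
      distr M (?P t \<Otimes>\<^sub>M ?P t) (\<lambda>\<omega>. (\<lambda>j\<in>{1..t}. x (j + h) \<omega>, \<lambda>j\<in>{1..t}. w (j + h) \<omega>))"
    unfolding indep_var_distribution_eq by blast
  have "distr M (?P t) (\<lambda>\<omega>. \<lambda>j\<in>{1..t}. x (j + h) \<omega>) = signal_law t"
    using x_stat[unfolded strictly_stationary_def, rule_format, of "{1..t}" h] t
    unfolding signal_law_def by auto
  moreover have "distr M (?P t) (\<lambda>\<omega>. \<lambda>j\<in>{1..t}. w (j + h) \<omega>) = noise {1..t}"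
  proof -
    have W [measurable]: "(\<lambda>\<omega>. \<lambda>j\<in>{1..T}. w j \<omega>) \<in> M \<rightarrow>\<^sub>M ?P T"
      by (intro measurable_restrict w_meas)
    have "distr M (?P T) (\<lambda>\<omega>. \<lambda>j\<in>{1..T}. w j \<omega>) = PiM {1..T} (\<lambda>j. distr M borel (w j))"
      using indep_vars_iff_distr_eq_PiM'[where I = "{1..T}" and M' = "\<lambda>_. borel" and X = w] w_indep w_meas t by auto
    also have "\<dots> = noise {1..T}"
      unfolding noise_def by (intro PiM_cong refl distr_w)
    finally have WT: "distr M (?P T) (\<lambda>\<omega>. \<lambda>j\<in>{1..T}. w j \<omega>) = noise {1..T}" .
    have "distr M (?P t) (\<lambda>\<omega>. \<lambda>j\<in>{1..t}. w (j + h) \<omega>) = distr (noise {1..T}) (?P t) r"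
      unfolding WT[symmetric] distr_distr[OF r W] rr ..
    also have "\<dots> = distr (noise {1..T}) (noise {1..t}) r"
      by (rule distr_cong) simp_all
    also have "\<dots> = noise {1..t}"
      unfolding noise_def r_def using t
      by (intro distr_PiM_reindex prob_space_gauss) (auto simp: inj_on_def)
    finally show ?thesis .
  qed
  ultimately show ?thesis using * by simp
qed

text \<open>One abstract risk describes every window of length \<open>t\<close>. Shift 0 relates it
  to the mean-square error of round \<open>t\<close>, shift 1 compares consecutive rounds.\<close>

lemma risk_shift:
  assumes t: "1 \<le> t" "t + k \<le> T" and [measurable]: "h \<in> borel_measurable (PiM {1..t} (\<lambda>_. borel))"
  shows "risk (signal_law t) {1..t} t \<rho> h =
    (\<integral>\<^sup>+\<omega>. ennreal ((x (t + k) \<omega> - h (\<lambda>j\<in>{1..t}. x (j + k) \<omega> + sqrt (\<rho> j) * w (j + k) \<omega>))\<^sup>2) \<partial>M)"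
proof -
  let ?P = "PiM {1..t} (\<lambda>_. borel :: real measure)"
  interpret S: signal "signal_law t" "{1..t}" t
    using t by (intro signal_signal_law) auto
  interpret N: prob_space "noise {1..t}" by (rule prob_space_noise)
  have [simp]: "Suc 0 \<le> t" using t by simp
  define G where "G = (\<lambda>(a, b). ennreal ((a t - h (observe {1..t} \<rho> a b))\<^sup>2))"
  have [measurable]: "G \<in> borel_measurable (?P \<Otimes>\<^sub>M ?P)"
    unfolding G_def by measurable
  have [measurable]: "(\<lambda>\<omega>. \<lambda>j\<in>{1..t}. x (j + k) \<omega>) \<in> M \<rightarrow>\<^sub>M ?P" "(\<lambda>\<omega>. \<lambda>j\<in>{1..t}. w (j + k) \<omega>) \<in> M \<rightarrow>\<^sub>M ?P"
    using t by (intro measurable_restrict x_meas w_meas; auto)+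
  have "risk (signal_law t) {1..t} t \<rho> h = (\<integral>\<^sup>+a. \<integral>\<^sup>+b. G (a, b) \<partial>noise {1..t} \<partial>signal_law t)"
    by (simp add: risk_def G_def)
  also have "\<dots> = (\<integral>\<^sup>+p. G p \<partial>(signal_law t \<Otimes>\<^sub>M noise {1..t}))"
    by (rule N.nn_integral_fst) measurable
  also have "\<dots> = (\<integral>\<^sup>+\<omega>. G (\<lambda>j\<in>{1..t}. x (j + k) \<omega>, \<lambda>j\<in>{1..t}. w (j + k) \<omega>) \<partial>M)"
    unfolding indep_signal_noise[OF t, symmetric] by (rule nn_integral_distr) measurable
  also have "\<dots> = (\<integral>\<^sup>+\<omega>. ennreal ((x (t + k) \<omega> -
      h (\<lambda>j\<in>{1..t}. x (j + k) \<omega> + sqrt (\<rho> j) * w (j + k) \<omega>))\<^sup>2) \<partial>M)"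
    using t by (simp add: G_def observe_def cong: restrict_cong)
  finally show ?thesis .
qed

text \<open>Beyond the optimality of conditional expectation only a change of format is needed, from
  a pair (current, past) to one vector on \<open>{1..t}\<close>. The attaining estimator is recorded
  because it is the one fed into the splitting bound.\<close>

lemma min_risk_eq_se_phi:
  assumes t: "1 \<le> t" "t \<le> T"
  shows "min_risk (signal_law t) {1..t} t (taus(t := \<tau>)) = ennreal (se_phi M x w taus t \<tau>)"
    and "\<exists>h\<in>borel_measurable (PiM {1..t} (\<lambda>_. borel)).
      risk (signal_law t) {1..t} t (taus(t := \<tau>)) h = ennreal (se_phi M x w taus t \<tau>)"
proof -
  let ?P = "\<lambda>I. PiM I (\<lambda>_. borel :: real measure)"
  define z where "z \<omega> = x t \<omega> + sqrt \<tau> * w t \<omega>" for \<omega>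
  define Z where "Z j \<omega> = x j \<omega> + sqrt (taus j) * w j \<omega>" for j \<omega>
  have zZ: "z \<in> borel_measurable M" "\<And>j. j \<in> {1..<t} \<Longrightarrow> Z j \<in> borel_measurable M"
    unfolding z_def Z_def using t
    by (auto intro!: borel_measurable_add borel_measurable_times x_meas w_meas)
  have phi: "se_phi M x w taus t \<tau> = mmse M (x t) z {1..<t} Z"
    by (simp add: se_phi_def z_def[abs_def] Z_def[abs_def])
  have xt: "x t \<in> borel_measurable M" "integrable M (\<lambda>\<omega>. (x t \<omega>)\<^sup>2)"
    using t x_meas x_var by auto
  have le: "ennreal (se_phi M x w taus t \<tau>) \<le>
      (\<integral>\<^sup>+\<omega>. ennreal ((x t \<omega> - h (z \<omega>, \<lambda>j\<in>{1..<t}. Z j \<omega>))\<^sup>2) \<partial>M)"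
    if "h \<in> borel_measurable (borel \<Otimes>\<^sub>M ?P {1..<t})" for h
    unfolding phi using xt zZ that by (rule mmse_le)
  define obs where "obs \<omega> = (\<lambda>j\<in>{1..t}. x j \<omega> + sqrt ((taus(t := \<tau>)) j) * w j \<omega>)" for \<omega>
  have risk: "risk (signal_law t) {1..t} t (taus(t := \<tau>)) h =
      (\<integral>\<^sup>+\<omega>. ennreal ((x t \<omega> - h (obs \<omega>))\<^sup>2) \<partial>M)" if "h \<in> borel_measurable (?P {1..t})" for h
    using risk_shift[of t 0 h] t that unfolding obs_def by simp
  have lower: "ennreal (se_phi M x w taus t \<tau>) \<le> risk (signal_law t) {1..t} t (taus(t := \<tau>)) h"
    if h: "h \<in> borel_measurable (?P {1..t})" for h
  proof -
    \<comment> \<open>Assembles the pair into a vector; \<open>k\<close> below takes the vector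
      apart again.\<close>
    define e :: "real \<times> (nat \<Rightarrow> real) \<Rightarrow> nat \<Rightarrow> real"
      where "e p = (\<lambda>j\<in>{1..t}. if j = t then fst p else snd p j)" for p
    have "e \<in> (borel \<Otimes>\<^sub>M ?P {1..<t}) \<rightarrow>\<^sub>M ?P {1..t}"
      unfolding e_def
    proof (rule measurable_restrict)
      fix j assume "j \<in> {1..t}"
      then show "(\<lambda>p. if j = t then fst p else snd p j) \<in> borel_measurable (borel \<Otimes>\<^sub>M ?P {1..<t})"
        by (cases "j = t") (auto intro!: measurable_compose[OF measurable_snd measurable_component_singleton])
    qed
    then have "ennreal (se_phi M x w taus t \<tau>) \<le>
        (\<integral>\<^sup>+\<omega>. ennreal ((x t \<omega> - h (e (z \<omega>, \<lambda>j\<in>{1..<t}. Z j \<omega>)))\<^sup>2) \<partial>M)"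
      by (intro le measurable_compose[OF _ h])
    moreover have "e (z \<omega>, \<lambda>j\<in>{1..<t}. Z j \<omega>) = obs \<omega>" for \<omega>
      by (auto simp: e_def obs_def z_def Z_def fun_eq_iff)
    ultimately show ?thesis unfolding risk[OF h] by simp
  qed
  have "\<exists>h\<in>borel_measurable (borel \<Otimes>\<^sub>M ?P {1..<t}). ennreal (se_phi M x w taus t \<tau>) =
      (\<integral>\<^sup>+\<omega>. ennreal ((x t \<omega> - h (z \<omega>, \<lambda>j\<in>{1..<t}. Z j \<omega>))\<^sup>2) \<partial>M)"
    unfolding phi using xt zZ by (rule mmse_attained)
  then obtain h where h [measurable]: "h \<in> borel_measurable (borel \<Otimes>\<^sub>M ?P {1..<t})"
    and h_eq: "ennreal (se_phi M x w taus t \<tau>) =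
      (\<integral>\<^sup>+\<omega>. ennreal ((x t \<omega> - h (z \<omega>, \<lambda>j\<in>{1..<t}. Z j \<omega>))\<^sup>2) \<partial>M)"
    by blast
  define k where "k y = h (y t, restrict y {1..<t})" for y :: "nat \<Rightarrow> real"
  have "(\<lambda>y. restrict y {1..<t}) \<in> ?P {1..t} \<rightarrow>\<^sub>M ?P {1..<t}"
    by (rule measurable_restrict_subset) auto
  moreover have "(\<lambda>y. y t) \<in> borel_measurable (?P {1..t})"
    using t by (intro measurable_component_singleton) auto
  ultimately have k: "k \<in> borel_measurable (?P {1..t})"
    unfolding k_def by measurable
  have "(z \<omega>, \<lambda>j\<in>{1..<t}. Z j \<omega>) = (obs \<omega> t, restrict (obs \<omega>) {1..<t})" for \<omega>
    using t by (auto simp: obs_def z_def Z_def fun_eq_iff)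
  then have k_eq: "risk (signal_law t) {1..t} t (taus(t := \<tau>)) k = ennreal (se_phi M x w taus t \<tau>)"
    unfolding risk[OF k] h_eq k_def by simp
  show "\<exists>h\<in>borel_measurable (?P {1..t}).
      risk (signal_law t) {1..t} t (taus(t := \<tau>)) h = ennreal (se_phi M x w taus t \<tau>)"
    using k k_eq by blast
  show "min_risk (signal_law t) {1..t} t (taus(t := \<tau>)) = ennreal (se_phi M x w taus t \<tau>)"
    unfolding min_risk_def
  proof (rule antisym)
    show "(INF h\<in>borel_measurable (?P {1..t}). risk (signal_law t) {1..t} t (taus(t := \<tau>)) h) \<le>
        ennreal (se_phi M x w taus t \<tau>)"
      unfolding k_eq[symmetric] using k by (rule INF_lower)
  qed (intro INF_greatest lower)
qed

lemma se_phi_nonneg: "0 \<le> se_phi M x w taus t \<tau>"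
  unfolding se_phi_def mmse_def Let_def by simp

text \<open>Stationarity identifies round \<open>t\<close> with round \<open>t + 1\<close> deprived of its first observation.\<close>

lemma min_risk_Suc_le:
  assumes t: "1 \<le> t" "Suc t \<le> T"
  shows "min_risk (signal_law (Suc t)) {1..Suc t} (Suc t) \<rho> \<le>
    min_risk (signal_law t) {1..t} t (\<lambda>j. \<rho> (Suc j))"
  unfolding min_risk_def[of "signal_law t"]
proof (rule INF_greatest)
  let ?P = "\<lambda>I. PiM I (\<lambda>_. borel :: real measure)"
  fix h :: "(nat \<Rightarrow> real) \<Rightarrow> real"
  assume h: "h \<in> borel_measurable (?P {1..t})"
  define r :: "(nat \<Rightarrow> real) \<Rightarrow> nat \<Rightarrow> real" where "r y = (\<lambda>j\<in>{1..t}. y (Suc j))" for y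
  have "r \<in> ?P {1..Suc t} \<rightarrow>\<^sub>M ?P {1..t}"
    unfolding r_def by (intro measurable_restrict measurable_component_singleton) auto
  then have hr: "(\<lambda>y. h (r y)) \<in> borel_measurable (?P {1..Suc t})"
    by (rule measurable_compose[OF _ h])
  \<comment> \<open>The shifts 0 and 1 are written out to match the two instances of
    \<open>risk_shift\<close>; \<open>r\<close> discards the first observation and renumbers the
    rest.\<close>
  have r_obs: "r (\<lambda>j\<in>{1..Suc t}. x (j + 0) \<omega> + sqrt (\<rho> j) * w (j + 0) \<omega>) =
      (\<lambda>j\<in>{1..t}. x (j + 1) \<omega> + sqrt (\<rho> (Suc j)) * w (j + 1) \<omega>)" for \<omega>
    by (auto simp: r_def fun_eq_iff)
  have "risk (signal_law (Suc t)) {1..Suc t} (Suc t) \<rho> (\<lambda>y. h (r y)) =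
      risk (signal_law t) {1..t} t (\<lambda>j. \<rho> (Suc j)) h"
    using risk_shift[of "Suc t" 0, OF _ _ hr, of \<rho>] risk_shift[of t 1, OF _ _ h, of "\<lambda>j. \<rho> (Suc j)"] t
    unfolding r_obs by simp
  then show "min_risk (signal_law (Suc t)) {1..Suc t} (Suc t) \<rho> \<le>
      risk (signal_law t) {1..t} t (\<lambda>j. \<rho> (Suc j)) h"
    unfolding min_risk_def using INF_lower[OF hr] by metis
qed

lemma se_phi_Suc_le:
  assumes t: "1 \<le> t" "Suc t \<le> T" and \<tau>: "0 < \<tau>"
    and taus: "\<And>j. 1 \<le> j \<Longrightarrow> j < t \<Longrightarrow> taus (Suc j) \<le> taus j"
      "\<And>j. 1 \<le> j \<Longrightarrow> j \<le> t \<Longrightarrow> 0 < taus j"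
  shows "se_phi M x w taus (Suc t) \<tau> \<le> se_phi M x w taus t \<tau>"
proof -
  interpret S: signal "signal_law t" "{1..t}" t
    using t by (intro signal_signal_law) auto
  have "ennreal (se_phi M x w taus (Suc t) \<tau>) =
      min_risk (signal_law (Suc t)) {1..Suc t} (Suc t) (taus(Suc t := \<tau>))"
    using t by (subst min_risk_eq_se_phi) auto
  also have "\<dots> \<le> min_risk (signal_law t) {1..t} t (\<lambda>j. (taus(Suc t := \<tau>)) (Suc j))"
    using t by (rule min_risk_Suc_le)
  also have "\<dots> \<le> min_risk (signal_law t) {1..t} t (taus(t := \<tau>))"
  proof (rule S.min_risk_mono)
    \<comment> \<open>At \<open>j = t\<close> both sides are the current variance
      \<open>\<tau>\<close>; for \<open>j < t\<close> the variances of neighbouring earlier rounds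
      are compared.\<close>
    fix j assume j: "j \<in> {1..t}"
    show "0 < (taus(Suc t := \<tau>)) (Suc j)"
      using j taus(2)[of "Suc j"] \<tau> by (cases "j = t") auto
    show "(taus(Suc t := \<tau>)) (Suc j) \<le> (taus(t := \<tau>)) j"
      using j taus(1)[of j] by (cases "j = t") auto
  qed
  also have "\<dots> = ennreal (se_phi M x w taus t \<tau>)"
    using t by (subst min_risk_eq_se_phi) auto
  finally show ?thesis by (simp add: se_phi_nonneg)
qed

text \<open>Best affine estimation from the current observation. It yields both
  \<open>\<phi> < \<tau>\<close>, so that \<open>g\<close> is finite, and the bound of
  \<open>g\<close> by the variance that starts the recursion downwards.\<close>

lemma se_phi_le_linear:
  assumes t: "1 \<le> t" "t \<le> T" and \<tau>: "0 < \<tau>"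
  shows "se_phi M x w taus t \<tau> \<le> variance (x t) * \<tau> / (variance (x t) + \<tau>)"
proof -
  interpret S: signal "signal_law t" "{1..t}" t
    using t by (intro signal_signal_law) auto
  have x [measurable]: "x t \<in> borel_measurable M" "integrable M (\<lambda>\<omega>. (x t \<omega>)\<^sup>2)"
    using t x_meas x_var by auto
  have [simp]: "Suc 0 \<le> t" using t by simp
  have X: "(\<lambda>\<omega>. \<lambda>j\<in>{1..t}. x j \<omega>) \<in> M \<rightarrow>\<^sub>M PiM {1..t} (\<lambda>_. borel)"
    using t by (intro measurable_restrict x_meas) auto
  define V where "V = variance (x t)"
  have V0: "V \<ge> 0" unfolding V_def by (rule variance_positive)
  have "integrable M (x t)"
    using x by (rule square_integrable_imp_integrable)
  then have "integrable M (\<lambda>\<omega>. (x t \<omega> - expectation (x t))\<^sup>2)"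
    using x by (simp add: power2_diff)
  then have V: "(\<integral>\<^sup>+\<omega>. ennreal ((x t \<omega> - expectation (x t))\<^sup>2) \<partial>M) = ennreal V"
    unfolding V_def by (simp add: nn_integral_eq_integral)
  have law: "(\<integral>\<^sup>+y. ennreal ((y t - expectation (x t))\<^sup>2) \<partial>signal_law t) = ennreal V"
    unfolding signal_law_def V[symmetric] by (subst nn_integral_distr[OF X]) auto
  define c where "c = V / (V + \<tau>)"
  have "ennreal (se_phi M x w taus t \<tau>) = min_risk (signal_law t) {1..t} t (taus(t := \<tau>))"
    using t by (subst min_risk_eq_se_phi) auto
  also have "\<dots> \<le> ennreal ((1 - c)\<^sup>2) * ennreal V + ennreal (c\<^sup>2 * \<tau>)"
    using S.min_risk_le_linear[of "taus(t := \<tau>)" c "expectation (x t)"] \<tau> by (simp add: law)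
  also have "\<dots> = ennreal ((1 - c)\<^sup>2 * V + c\<^sup>2 * \<tau>)"
    using V0 \<tau> by (simp add: ennreal_mult)
  also have "(1 - c)\<^sup>2 * V + c\<^sup>2 * \<tau> = V * \<tau> / (V + \<tau>)"
    unfolding c_def using V0 \<tau> by (rule weighted_bound_optimum)
  finally show ?thesis
    using V0 \<tau> by (simp add: V_def)
qed

text \<open>For positive errors this says
  \<open>1/\<phi>(\<tau>1) \<ge> 1/\<phi>(\<tau>2) + 1/b\<close>, where
  \<open>1/b = 1/\<tau>1 - 1/\<tau>2\<close> is the gain in precision.\<close>

lemma se_phi_le_split:
  fixes taus :: "nat \<Rightarrow> real"
  assumes t: "1 \<le> t" "t \<le> T" and \<tau>: "0 < \<tau>1" "\<tau>1 < \<tau>2"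
  defines "p \<equiv> se_phi M x w taus t \<tau>2" and "b \<equiv> \<tau>1 * \<tau>2 / (\<tau>2 - \<tau>1)"
  shows "se_phi M x w taus t \<tau>1 \<le> p * b / (p + b)"
proof -
  interpret S: signal "signal_law t" "{1..t}" t
    using t by (intro signal_signal_law) auto
  have p: "p \<ge> 0" unfolding p_def by (rule se_phi_nonneg)
  have b: "b > 0" using \<tau> by (simp add: b_def)
  obtain m where m: "m \<in> borel_measurable (PiM {1..t} (\<lambda>_. borel))"
    and m_eq: "risk (signal_law t) {1..t} t (taus(t := \<tau>2)) m = ennreal p"
    using min_risk_eq_se_phi(2)[OF t] unfolding p_def by blast
  define c where "c = p / (p + b)"
  have "ennreal (se_phi M x w taus t \<tau>1) = min_risk (signal_law t) {1..t} t (taus(t := \<tau>1))"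
    using t by (subst min_risk_eq_se_phi) auto
  also have "\<dots> \<le> ennreal ((1 - c)\<^sup>2) * ennreal p + ennreal (c\<^sup>2 * b)"
    using S.min_risk_le_split[OF S.t_in_J _ \<tau> m, of c taus] unfolding m_eq b_def by simp
  also have "\<dots> = ennreal ((1 - c)\<^sup>2 * p + c\<^sup>2 * b)"
    using p b by (simp add: ennreal_mult)
  also have "(1 - c)\<^sup>2 * p + c\<^sup>2 * b = p * b / (p + b)"
    unfolding c_def using p b by (rule weighted_bound_optimum)
  finally show ?thesis
    using p b by simp
qed

end

section \<open>Monotonicity of the transfer function in its argument and in the round\<close>

section \<open>State evolution\<close>

lemma se_g_eq:
  assumes "0 \<le> se_phi M x w taus t \<tau>" "se_phi M x w taus t \<tau> < \<tau>"
  shows "se_g M x w taus t \<tau> = se_phi M x w taus t \<tau> * \<tau> / (\<tau> - se_phi M x w taus t \<tau>)"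
\<comment> \<open>For a zero error the extended reciprocal is infinite and \<open>g\<close> is 0, in
  agreement with the real quotient.\<close>
proof (cases "se_phi M x w taus t \<tau> = 0")
  case True
  then show ?thesis
    using assms by (simp add: se_g_def divide_ereal_def)
next
  case False
  define p where "p = se_phi M x w taus t \<tau>"
  have p: "0 < p" "p < \<tau>"
    using assms False by (simp_all add: p_def)
  have "1 / (1 / ereal p - 1 / ereal \<tau>) = ereal (1 / (1 / p - 1 / \<tau>))"
    using p by (simp add: one_ereal_def field_simps)
  also have "1 / (1 / p - 1 / \<tau>) = p * \<tau> / (\<tau> - p)"
    using p by (simp add: field_simps)
  finally show ?thesis
    unfolding se_g_def p_def[symmetric] by simp
qed

context stationary_signal
begin

lemma se_phi_less:
  assumes t: "1 \<le> t" "t \<le> T" and \<tau>: "0 < \<tau>"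
  shows "se_phi M x w taus t \<tau> < \<tau>"
proof -
  define V where "V = variance (x t)"
  have "V \<ge> 0" unfolding V_def by (rule variance_positive)
  then have "V * \<tau> / (V + \<tau>) < \<tau>"
    using \<tau> by (simp add: field_simps)
  then show ?thesis
    using se_phi_le_linear[OF t \<tau>, of taus] unfolding V_def by linarith
qed

lemma se_g_nonneg:
  assumes "1 \<le> t" "t \<le> T" "0 < \<tau>"
  shows "0 \<le> se_g M x w taus t \<tau>"
  using se_phi_less[OF assms, of taus] se_phi_nonneg[of taus t \<tau>] assms
  by (simp add: se_g_eq)

text \<open>The map sending \<open>v\<close> to \<open>v * \<tau> / (v + \<tau>)\<close> is
  increasing and inverts the passage from the error to \<open>g\<close>. Comparisons of
  \<open>g\<close> thus become upper bounds on the error.\<close>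

lemma se_g_le_iff:
  assumes t: "1 \<le> t" "t \<le> T" and \<tau>: "0 < \<tau>" and v: "0 \<le> v"
  shows "se_g M x w taus t \<tau> \<le> v \<longleftrightarrow> se_phi M x w taus t \<tau> \<le> v * \<tau> / (v + \<tau>)"
proof -
  define p where "p = se_phi M x w taus t \<tau>"
  have p: "0 \<le> p" "p < \<tau>"
    unfolding p_def by (rule se_phi_nonneg, rule se_phi_less[OF t \<tau>])
  have "se_g M x w taus t \<tau> = p * \<tau> / (\<tau> - p)"
    using se_g_eq[of M x w taus t \<tau>] p unfolding p_def by simp
  then have "se_g M x w taus t \<tau> \<le> v \<longleftrightarrow> p * \<tau> \<le> v * (\<tau> - p)"
    using p by (simp add: pos_divide_le_eq)
  also have "\<dots> \<longleftrightarrow> p * (v + \<tau>) \<le> v * \<tau>"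
    by (auto simp: algebra_simps)
  also have "\<dots> \<longleftrightarrow> p \<le> v * \<tau> / (v + \<tau>)"
    using v \<tau> by (simp add: pos_le_divide_eq)
  finally show ?thesis unfolding p_def .
qed

lemma se_g_le_variance:
  assumes "1 \<le> t" "t \<le> T" "0 < \<tau>"
  shows "se_g M x w taus t \<tau> \<le> variance (x t)"
  using se_phi_le_linear[OF assms, of taus] variance_positive[of "x t"]
  by (subst se_g_le_iff[OF assms]) auto

text \<open>In terms of precisions: the error at \<open>\<tau>2\<close> has precision at least
  \<open>1/v + 1/\<tau>2\<close>, and the split adds \<open>1/\<tau>1 - 1/\<tau>2\<close>, leaving
  at least \<open>1/v + 1/\<tau>1\<close>.\<close>

lemma se_g_mono:
  assumes t: "1 \<le> t" "t \<le> T" and \<tau>: "0 < \<tau>1" "\<tau>1 \<le> \<tau>2"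
  shows "se_g M x w taus t \<tau>1 \<le> se_g M x w taus t \<tau>2"
proof (cases "\<tau>1 = \<tau>2")
  case False
  define p v b where "p = se_phi M x w taus t \<tau>2" and "v = se_g M x w taus t \<tau>2"
    and "b = \<tau>1 * \<tau>2 / (\<tau>2 - \<tau>1)"
  have less: "\<tau>1 < \<tau>2" and \<tau>2: "0 < \<tau>2" using False \<tau> by auto
  have b: "b > 0" using \<tau> less by (simp add: b_def)
  have v: "v \<ge> 0" unfolding v_def using t \<tau>2 by (rule se_g_nonneg)
  have p: "0 \<le> p" unfolding p_def by (rule se_phi_nonneg)
  have p_le: "p \<le> v * \<tau>2 / (v + \<tau>2)"
    using se_g_le_iff[OF t \<tau>2 v, of taus] by (simp add: p_def v_def)
  have mono: "p * b / (p + b) \<le> q * b / (q + b)" if "p \<le> q" for q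
    using that p b by (simp add: frac_le_eq divide_le_0_iff field_simps)
  have "se_phi M x w taus t \<tau>1 \<le> p * b / (p + b)"
    unfolding p_def b_def using t \<tau>(1) less by (rule se_phi_le_split)
  also have "\<dots> \<le> (v * \<tau>2 / (v + \<tau>2)) * b / (v * \<tau>2 / (v + \<tau>2) + b)"
    using p_le by (rule mono)
  \<comment> \<open>The term in \<open>1/\<tau>2\<close> cancels; denominators are cleared since
    \<open>v\<close> may be 0.\<close>
  also have "\<dots> = v * \<tau>1 / (v + \<tau>1)"
  proof -
    define d where "d = \<tau>2 - \<tau>1"
    have nz: "d \<noteq> 0" "v + \<tau>2 \<noteq> 0" "v + \<tau>1 \<noteq> 0" "\<tau>2 \<noteq> 0"
      using v \<tau> less by (auto simp: d_def)
    have "v * \<tau>2 / (v + \<tau>2) + b = \<tau>2 * (v * d + \<tau>1 * (v + \<tau>2)) / ((v + \<tau>2) * d)"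
      using nz unfolding b_def d_def[symmetric] by (simp add: field_simps)
    also have "v * d + \<tau>1 * (v + \<tau>2) = \<tau>2 * (v + \<tau>1)"
      by (simp add: d_def algebra_simps)
    finally have "v * \<tau>2 / (v + \<tau>2) + b = \<tau>2 * (\<tau>2 * (v + \<tau>1)) / ((v + \<tau>2) * d)" .
    moreover have "(v * \<tau>2 / A) * (\<tau>1 * \<tau>2 / d) / (\<tau>2 * (\<tau>2 * B) / (A * d)) = v * \<tau>1 / B"
      if "A \<noteq> 0" "B \<noteq> 0" for A B
      using that nz by (simp add: field_simps)
    ultimately show ?thesis
      using nz by (simp add: b_def d_def)
  qed
  finally show ?thesis
    unfolding v_def[symmetric] using se_g_le_iff[OF t \<tau>(1) v, of taus] by simp
qed simp

lemma se_g_Suc_le: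
  assumes t: "1 \<le> t" "Suc t \<le> T" and \<tau>: "0 < \<tau>"
    and taus: "\<And>j. 1 \<le> j \<Longrightarrow> j < t \<Longrightarrow> taus (Suc j) \<le> taus j"
      "\<And>j. 1 \<le> j \<Longrightarrow> j \<le> t \<Longrightarrow> 0 < taus j"
  shows "se_g M x w taus (Suc t) \<tau> \<le> se_g M x w taus t \<tau>"
proof -
  have t': "t \<le> T" "1 \<le> Suc t" using t by auto
  have v: "0 \<le> se_g M x w taus t \<tau>"
    using t(1) t'(1) \<tau> by (rule se_g_nonneg)
  have "se_phi M x w taus (Suc t) \<tau> \<le> se_phi M x w taus t \<tau>"
    by (rule se_phi_Suc_le[OF t \<tau>]) (use taus in auto)
  also have "\<dots> \<le> se_g M x w taus t \<tau> * \<tau> / (se_g M x w taus t \<tau> + \<tau>)"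
    using se_g_le_iff[OF t(1) t'(1) \<tau> v, of taus] by simp
  finally show ?thesis
    using se_g_le_iff[OF t'(2) t(2) \<tau> v, of taus] by simp
qed

text \<open>Stationarity for a window of a single time; it makes all rounds start from the same
  value.\<close>

lemma variance_stationary:
  assumes "1 \<le> t" "Suc t \<le> T"
  shows "variance (x (Suc t)) = variance (x t)"
proof -
  let ?P = "PiM {t} (\<lambda>_. borel :: real measure)"
  have [measurable]: "x t \<in> borel_measurable M" "x (Suc t) \<in> borel_measurable M"
    using assms x_meas by auto
  have law: "distr M ?P (\<lambda>\<omega>. \<lambda>j\<in>{t}. x (j + 1) \<omega>) = distr M ?P (\<lambda>\<omega>. \<lambda>j\<in>{t}. x j \<omega>)"
    using x_stat[unfolded strictly_stationary_def, rule_format, of "{t}" 1] assms by auto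
  have m: "(\<lambda>\<omega>. \<lambda>j\<in>{t}. x (j + 1) \<omega>) \<in> M \<rightarrow>\<^sub>M ?P" "(\<lambda>\<omega>. \<lambda>j\<in>{t}. x j \<omega>) \<in> M \<rightarrow>\<^sub>M ?P"
    by (intro measurable_restrict; simp)+
  have eq: "expectation (\<lambda>\<omega>. f (x (Suc t) \<omega>)) = expectation (\<lambda>\<omega>. f (x t \<omega>))"
    if [measurable]: "f \<in> borel_measurable borel" for f :: "real \<Rightarrow> real"
  proof -
    have f: "(\<lambda>y. f (y t)) \<in> borel_measurable ?P" by measurable
    show ?thesis
      using integral_distr[OF m(1) f] integral_distr[OF m(2) f] unfolding law by simp
  qed
  show ?thesis
    using eq[of "\<lambda>y. y"] eq[of "\<lambda>y. (y - expectation (x t))\<^sup>2"] by simp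
qed

end

section \<open>The recursion, its limits, and the comparison of consecutive rounds\<close>

locale state_evolution = stationary_signal M x w T
  for M :: "'a measure" and x w :: "nat \<Rightarrow> 'a \<Rightarrow> real" and T :: nat +
  fixes N s :: nat and sigma2 :: real
  assumes s: "1 \<le> s" "s \<le> N" and sigma2: "0 < sigma2"
begin

abbreviation "f \<equiv> se_f N s sigma2"
abbreviation "v \<equiv> se_v M x w N s sigma2"
abbreviation "\<tau> \<equiv> se_tau M x w N s sigma2"
abbreviation "\<tau>_lim \<equiv> tau_star M x w N s sigma2"
abbreviation "v_lim \<equiv> v_star M x w N s sigma2"

lemma f_mono: "a \<le> b \<Longrightarrow> f a \<le> f b"
  using s by (auto simp: se_f_def intro!: mult_left_mono)

lemma f_ge: "0 \<le> a \<Longrightarrow> sigma2 \<le> f a"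
  using s by (auto simp: se_f_def intro!: mult_nonneg_nonneg)

lemma v_nonneg:
  assumes "1 \<le> t" "t \<le> T"
  shows "0 \<le> v t i"
proof (induction i)
  case 0
  then show ?case by (simp add: se_v_0 variance_positive)
next
  case (Suc i)
  then show ?case
    unfolding se_v_Suc using f_ge[of "v t i"] sigma2 assms
    by (intro se_g_nonneg) (auto simp: se_tau_def)
qed

lemma tau_pos: "1 \<le> t \<Longrightarrow> t \<le> T \<Longrightarrow> sigma2 \<le> \<tau> t i"
  unfolding se_tau_def by (intro f_ge v_nonneg)

lemma v_decseq:
  assumes t: "1 \<le> t" "t \<le> T"
  shows "decseq (v t)"
proof (rule decseq_SucI)
  show "v t (Suc i) \<le> v t i" for i
  proof (induction i)
    case 0
    have "0 < \<tau> t 0" using tau_pos[OF t, of 0] sigma2 by simp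
    with t show ?case unfolding se_v_Suc se_v_0 by (rule se_g_le_variance)
  next
    case (Suc i)
    have "0 < \<tau> t (Suc i)" using tau_pos[OF t, of "Suc i"] sigma2 by simp
    moreover have "\<tau> t (Suc i) \<le> \<tau> t i" unfolding se_tau_def using Suc by (rule f_mono)
    ultimately show ?case unfolding se_v_Suc[of M x w N s sigma2 t "Suc i"] se_v_Suc[of M x w N s sigma2 t i]
      using t by (intro se_g_mono) (auto simp flip: se_v_Suc)
  qed
qed

text \<open>The starred quantities are defined by the total operator \<open>lim\<close>. Monotone
  decrease and the lower bound 0 make them genuine limits, and \<open>f\<close> is
  continuous.\<close>

lemma limits:
  assumes t: "1 \<le> t" "t \<le> T"
  shows "v t \<longlonglongrightarrow> v_lim t" and "\<tau> t \<longlonglongrightarrow> \<tau>_lim t"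
proof -
  have "convergent (v t)"
    by (rule decseq_convergent[OF v_decseq[OF t], of 0]) (auto simp: v_nonneg[OF t] convergent_def)
  then show *: "v t \<longlonglongrightarrow> v_lim t"
    by (simp add: v_star_def convergent_LIMSEQ_iff)
  have "(\<lambda>i. f (v t i)) \<longlonglongrightarrow> f (v_lim t)"
    unfolding se_f_def by (intro tendsto_intros *)
  then have "\<tau> t \<longlonglongrightarrow> f (v_lim t)"
    by (simp add: se_tau_def[abs_def])
  then show "\<tau> t \<longlonglongrightarrow> \<tau>_lim t"
    unfolding tau_star_eq_lim by (metis limI)
qed

text \<open>The bound by \<open>sigma2\<close> survives the limit. Positive variances of the past
  observations are required when noise levels are compared.\<close>

lemma tau_lim_pos:
  assumes t: "1 \<le> t" "t \<le> T"
  shows "0 < \<tau>_lim t"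
  using LIMSEQ_le_const[OF limits(2)[OF t], of sigma2] tau_pos[OF t] sigma2 by fastforce

text \<open>Outer induction over rounds, inner induction over \<open>i\<close>: the outer hypothesis
  orders the noise of the past observations, the inner one orders the arguments of the transfer
  functions.\<close>

lemma v_Suc_le:
  assumes "1 \<le> t" "Suc t \<le> T"
  shows "v (Suc t) i \<le> v t i"
  using assms
proof (induction t arbitrary: i rule: less_induct)
  case (less t i)
  note t = \<open>1 \<le> t\<close> \<open>Suc t \<le> T\<close>
  have t': "1 \<le> Suc t" "t \<le> T" using t by auto
  have lim_le: "\<tau>_lim (Suc j) \<le> \<tau>_lim j" if j: "1 \<le> j" "j < t" for j
  proof (rule LIMSEQ_le)
    show "\<tau> (Suc j) \<longlonglongrightarrow> \<tau>_lim (Suc j)" "\<tau> j \<longlonglongrightarrow> \<tau>_lim j"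
      using j t by (auto intro!: limits(2))
    show "\<exists>n. \<forall>i\<ge>n. \<tau> (Suc j) i \<le> \<tau> j i"
      using less.IH[OF j(2) j(1)] j t unfolding se_tau_def by (auto intro!: f_mono)
  qed
  show ?case
  proof (induction i)
    case 0
    then show ?case using variance_stationary[OF t] by (simp add: se_v_0)
  next
    case (Suc i)
    have \<tau>: "0 < \<tau> (Suc t) i" "0 < \<tau> t i" "\<tau> (Suc t) i \<le> \<tau> t i"
      using tau_pos[OF t'(1) t(2), of i] tau_pos[OF t(1) t'(2), of i] sigma2 f_mono[OF Suc]
      by (auto simp: se_tau_def)
    \<comment> \<open>First the argument is enlarged within round \<open>t + 1\<close>, then the
      rounds are compared at that common argument.\<close>
    have "v (Suc t) (Suc i) \<le> se_g M x w \<tau>_lim (Suc t) (\<tau> t i)"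
      unfolding se_v_Suc using t'(1) t(2) \<tau>(1,3) by (rule se_g_mono)
    also have "\<dots> \<le> se_g M x w \<tau>_lim t (\<tau> t i)"
      using t \<tau>(2)
    proof (rule se_g_Suc_le)
      show "0 < \<tau>_lim j" if "1 \<le> j" "j \<le> t" for j
        using that t by (intro tau_lim_pos) auto
    qed (rule lim_le)
    finally show ?case unfolding se_v_Suc .
  qed
qed

lemma tau_Suc_le: "1 \<le> t \<Longrightarrow> Suc t \<le> T \<Longrightarrow> \<tau> (Suc t) i \<le> \<tau> t i"
  unfolding se_tau_def by (intro f_mono v_Suc_le)

lemma v_lim_Suc_le: "1 \<le> t \<Longrightarrow> Suc t \<le> T \<Longrightarrow> v_lim (Suc t) \<le> v_lim t"
  by (rule LIMSEQ_le[OF limits(1) limits(1)]) (auto intro!: v_Suc_le)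

lemma tau_lim_Suc_le: "1 \<le> t \<Longrightarrow> Suc t \<le> T \<Longrightarrow> \<tau>_lim (Suc t) \<le> \<tau>_lim t"
  by (rule LIMSEQ_le[OF limits(2) limits(2)]) (auto intro!: tau_Suc_le)

end

theorem theorem2:
  fixes M :: "'a measure"
    and x w :: "nat \<Rightarrow> 'a \<Rightarrow> real"
    and T N s :: nat
    and sigma2 :: real
  assumes "prob_space M"
    and "1 \<le> T"
    and "1 \<le> s" and "s \<le> N"
    and "sigma2 > 0"
    and x_meas: "\<And>t. t \<in> {1..T} \<Longrightarrow> x t \<in> borel_measurable M"
    and x_var: "\<And>t. t \<in> {1..T} \<Longrightarrow> integrable M (\<lambda>\<omega>. (x t \<omega>)\<^sup>2)"
    and x_markov: "markov_process M T x"
    and w_normal: "\<And>t. t \<in> {1..T} \<Longrightarrow> distributed M lborel (w t) std_normal_density"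
    and w_indep: "prob_space.indep_vars M (\<lambda>_. borel) w {1..T}"
    and xw_indep: "prob_space.indep_var M
          (PiM {1..T} (\<lambda>_. borel)) (\<lambda>\<omega>. \<lambda>t\<in>{1..T}. x t \<omega>)
          (PiM {1..T} (\<lambda>_. borel)) (\<lambda>\<omega>. \<lambda>t\<in>{1..T}. w t \<omega>)"
    and x_stat: "strictly_stationary M T x"
  shows "(\<forall>i\<ge>1. \<forall>t\<le>T. \<forall>r\<in>{2..t}.
            se_tau M x w N s sigma2 r i \<le> se_tau M x w N s sigma2 (r - 1) i \<and>
            se_v M x w N s sigma2 r i \<le> se_v M x w N s sigma2 (r - 1) i) \<and>
         (\<forall>t\<le>T. \<forall>r\<in>{2..t}.
            tau_star M x w N s sigma2 r \<le> tau_star M x w N s sigma2 (r - 1) \<and>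
            v_star M x w N s sigma2 r \<le> v_star M x w N s sigma2 (r - 1))"
proof -
  interpret prob_space M by fact
  interpret state_evolution M x w T N s sigma2
    by unfold_locales (fact assms)+
  have "se_tau M x w N s sigma2 r i \<le> se_tau M x w N s sigma2 (r - 1) i \<and>
      se_v M x w N s sigma2 r i \<le> se_v M x w N s sigma2 (r - 1) i \<and>
      tau_star M x w N s sigma2 r \<le> tau_star M x w N s sigma2 (r - 1) \<and>
      v_star M x w N s sigma2 r \<le> v_star M x w N s sigma2 (r - 1)"
    if r: "t \<le> T" "r \<in> {2..t}" for r t i
  proof -
    \<comment> \<open>Since \<open>r\<close> is at least 2, its predecessor is a genuine round and
      not the dummy round 0.\<close>
    obtain q where q: "r = Suc q" "1 \<le> q" "Suc q \<le> T"
      using r by (cases r) auto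
    then show ?thesis
      using tau_Suc_le v_Suc_le tau_lim_Suc_le v_lim_Suc_le by simp
  qed
  then show ?thesis by blast
qed

end
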